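(* Let $f\in\mathcal{F}_{0,U}$ be an $\mathbb{R}$-differentiable function, where $U$ is an open connected subset of $\mathbb{H}_0$ containing $0\in\mathbb{H}_0$. If $f$ is $\mathbb{R}$-analytic at $0\in U$, then $f$ is left $0$-regular on $U$ if and only if $$f=f(0)+\sum_{\mathbf{n}\in\mathbb{N}^3}\eta^{\mathbf{n}}f_{\mathbf{n}},\qquad\text{with}\qquad f_{\mathbf{n}}=\frac{1}{\mathbf{n}!}\,\frac{\partial^{n_1+n_2+n_3}f}{\partial x_2^{n_1}\partial x_3^{n_2}\partial x_4^{n_3}}(0),\quad\forall\,\mathbf{n}=(n_1,n_2,n_3)\in\mathbb{N}^3.$$
   Context: $\mathbb{H}_0$ (the $0$-scaled hypercomplexes) is the associative unital real algebra with $\mathbb{R}$-basis $\{1,i,j_0,k_0\}$ and multiplication determined by $i^2=-1$, $j_0^2=k_0^2=0$, $ij_0=k_0$, $j_0k_0=0$, $k_0i=j_0$, $j_0i=-k_0$, $ik_0=-j_0$, $k_0j_0=0$. Its elements are written $w=x_1+x_2i+x_3j_0+x_4k_0$ with $x_1,x_2,x_3,x_4\in\mathbb{R}$. Open subsets of $\mathbb{H}_0$ are those of the topology induced by the semi-norm $\|w\|_0=\sqrt{x_1^2+x_2^2}$. $\mathcal{F}_{0,U}$ is the set of functions $f:\mathbb{H}_0\to\mathbb{H}_0$ that are $\mathbb{R}$-differentiable on $U$ ($U$ being regarded as an open subset of $\mathbb{R}^4$); $\mathbb{R}$-analytic at $0$ means real analytic in $(x_1,x_2,x_3,x_4)$ at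 $0$. A function $f\in\mathcal{F}_{0,U}$ is left $0$-regular on $U$ if $$\nabla_0 f=\frac{\partial f}{\partial x_1}+i\frac{\partial f}{\partial x_2}+j_0\frac{\partial f}{\partial x_3}+k_0\frac{\partial f}{\partial x_4}=0$$ on $U$. The symmetrized product of functions $f_1,\dots,f_N:\mathbb{H}_0\to\mathbb{H}_0$ is $f_1\times\cdots\times f_N=\frac{1}{N!}\sum_{\sigma\in S_N}f_{\sigma(1)}f_{\sigma(2)}\cdots f_{\sigma(N)}$ (pointwise products in $\mathbb{H}_0$, $S_N$ the symmetric group on $\{1,\dots,N\}$), $f^{(n)}=f\times\cdots\times f$ ($n$ times) $=f^n$, and $f^{(0)}=1$. Put $\eta_2(w)=x_2-x_1i$, $\eta_3(w)=x_3-x_1j_0$, $\eta_4(w)=x_4-x_1k_0$. With $\mathbb{N}_0=\mathbb{N}\cup\{0\}$, for $\mathbf{n}=(n_1,n_2,n_3)\in\mathbb{N}_0^3$ put $\mathbf{n}!=(n_1!)(n_2!)(n_3!)$ and $$\eta^{\mathbf{n}}=\frac{1}{\mathbf{n}!}\left(\eta_2^{(n_1)}\times\eta_3^{(n_2)}\times\eta_4^{(n_3)}\right),$$ the product in parentheses being the symmetrized product of $n_1$ copies of $\eta_2$, $n_2$ copies of $\eta_3$ and $n_3$ copies of $\eta_4$.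
   Formalization: Here f_n has no second 1/n!; n runs over N_0^3 without 0. Proved: f regular on U gives the expansion near 0; the expansion on an open V in U containing 0 gives regularity on V; the iff (expansion near 0) holds if f is R-analytic on all of U. *)

theory Defs
  imports "HOL-Analysis.Analysis" "HOL-Combinatorics.Permutations"
begin

text \<open>The type \<open>hyp\<close> models the 0-scaled hypercomplexes; \<open>Hyp a b c d\<close> stands for
  \<open>a + b i + c j\<^sub>0 + d k\<^sub>0\<close>.\<close>

datatype hyp = Hyp (hx1: real) (hx2: real) (hx3: real) (hx4: real)

lemma hyp_eqI: "hx1 v = hx1 w \<Longrightarrow> hx2 v = hx2 w \<Longrightarrow> hx3 v = hx3 w \<Longrightarrow> hx4 v = hx4 w \<Longrightarrow> v = w"
  by (rule hyp.expand) simp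

lemma hyp_eq_iff: "v = w \<longleftrightarrow> hx1 v = hx1 w \<and> hx2 v = hx2 w \<and> hx3 v = hx3 w \<and> hx4 v = hx4 w"
  by (auto intro: hyp_eqI)

instantiation hyp :: real_algebra_1
begin

definition "0 = Hyp 0 0 0 0"
definition "1 = Hyp 1 0 0 0"
definition "v + w = Hyp (hx1 v + hx1 w) (hx2 v + hx2 w) (hx3 v + hx3 w) (hx4 v + hx4 w)"
definition "v - w = Hyp (hx1 v - hx1 w) (hx2 v - hx2 w) (hx3 v - hx3 w) (hx4 v - hx4 w)"
definition "- w = Hyp (- hx1 w) (- hx2 w) (- hx3 w) (- hx4 w)"
definition "r *\<^sub>R w = Hyp (r * hx1 w) (r * hx2 w) (r * hx3 w) (r * hx4 w)"

definition "v * w = Hyp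
  (hx1 v * hx1 w - hx2 v * hx2 w)
  (hx1 v * hx2 w + hx2 v * hx1 w)
  (hx1 v * hx3 w - hx2 v * hx4 w + hx3 v * hx1 w + hx4 v * hx2 w)
  (hx1 v * hx4 w + hx2 v * hx3 w - hx3 v * hx2 w + hx4 v * hx1 w)"

lemmas hyp_ops_defs =
  zero_hyp_def one_hyp_def plus_hyp_def minus_hyp_def uminus_hyp_def
  scaleR_hyp_def times_hyp_def

instance
  by standard (auto simp: hyp_ops_defs hyp_eq_iff algebra_simps)

end

lemma hyp_sel_simps [simp]:
  "hx1 0 = 0" "hx2 0 = 0" "hx3 0 = 0" "hx4 0 = 0"
  "hx1 1 = 1" "hx2 1 = 0" "hx3 1 = 0" "hx4 1 = 0"
  "hx1 (v + w) = hx1 v + hx1 w" "hx2 (v + w) = hx2 v + hx2 w"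
  "hx3 (v + w) = hx3 v + hx3 w" "hx4 (v + w) = hx4 v + hx4 w"
  "hx1 (v - w) = hx1 v - hx1 w" "hx2 (v - w) = hx2 v - hx2 w"
  "hx3 (v - w) = hx3 v - hx3 w" "hx4 (v - w) = hx4 v - hx4 w"
  "hx1 (- w) = - hx1 w" "hx2 (- w) = - hx2 w" "hx3 (- w) = - hx3 w" "hx4 (- w) = - hx4 w"
  "hx1 (r *\<^sub>R w) = r * hx1 w" "hx2 (r *\<^sub>R w) = r * hx2 w"
  "hx3 (r *\<^sub>R w) = r * hx3 w" "hx4 (r *\<^sub>R w) = r * hx4 w"
  by (simp_all add: hyp_ops_defs)

definition hi :: hyp where "hi = Hyp 0 1 0 0"
definition hj :: hyp where "hj = Hyp 0 0 1 0"
definition hk :: hyp where "hk = Hyp 0 0 0 1"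

lemma hyp_expansion: "w = hx1 w *\<^sub>R 1 + hx2 w *\<^sub>R hi + hx3 w *\<^sub>R hj + hx4 w *\<^sub>R hk"
  by (simp add: hyp_eq_iff hi_def hj_def hk_def)

lemma hyp_mult_table:
  "hi * hi = -1" "hj * hj = 0" "hk * hk = 0"
  "hi * hj = hk" "hj * hk = 0" "hk * hi = hj"
  "hj * hi = - hk" "hi * hk = - hj" "hk * hj = 0"
  by (simp_all add: hyp_ops_defs hi_def hj_def hk_def)

text \<open>The type class structure is the Euclidean one of \<open>\<real>\<^sup>4\<close>: differentiability and
  infinite sums refer to it. The coarser topology of the semi-norm is introduced
  separately below.\<close>

instantiation hyp :: real_inner
begin

definition inner_hyp :: "hyp \<Rightarrow> hyp \<Rightarrow> real" where
  "inner_hyp v w = hx1 v * hx1 w + hx2 v * hx2 w + hx3 v * hx3 w + hx4 v * hx4 w"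

definition norm_hyp :: "hyp \<Rightarrow> real" where
  "norm_hyp w = sqrt (inner w w)"

definition dist_hyp :: "hyp \<Rightarrow> hyp \<Rightarrow> real" where
  "dist_hyp v w = norm (v - w)"

definition sgn_hyp :: "hyp \<Rightarrow> hyp" where
  "sgn_hyp w = w /\<^sub>R norm w"

definition uniformity_hyp :: "(hyp \<times> hyp) filter" where
  "uniformity_hyp = (INF e\<in>{0<..}. principal {(v, w). dist v w < e})"

definition open_hyp :: "hyp set \<Rightarrow> bool" where
  "open_hyp U \<longleftrightarrow> (\<forall>v\<in>U. eventually (\<lambda>(v', w). v' = v \<longrightarrow> w \<in> U) uniformity)"

instance
proof
  fix v w z :: hyp and r :: real
  show "dist v w = norm (v - w)" by (fact dist_hyp_def)
  show "sgn w = w /\<^sub>R norm w" by (fact sgn_hyp_def)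
  show "uniformity = (INF e\<in>{0<..}. principal {(v::hyp, w). dist v w < e})"
    by (fact uniformity_hyp_def)
  show "open U \<longleftrightarrow> (\<forall>v\<in>U. \<forall>\<^sub>F (v', w) in uniformity. v' = v \<longrightarrow> w \<in> U)" for U :: "hyp set"
    by (fact open_hyp_def)
  show "inner v w = inner w v" by (simp add: inner_hyp_def mult.commute)
  show "inner (v + w) z = inner v z + inner w z"
    by (simp add: inner_hyp_def algebra_simps)
  show "inner (r *\<^sub>R v) w = r * inner v w"
    by (simp add: inner_hyp_def algebra_simps)
  show "0 \<le> inner v v" by (simp add: inner_hyp_def)
  show "inner v v = 0 \<longleftrightarrow> v = 0"
    by (simp add: inner_hyp_def hyp_eq_iff add_nonneg_eq_0_iff)
  show "norm v = sqrt (inner v v)" by (fact norm_hyp_def)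
qed

end

instantiation hyp :: euclidean_space
begin

definition Basis_hyp :: "hyp set" where
  "Basis_hyp = {1, hi, hj, hk}"

instance
proof
  show "(Basis :: hyp set) \<noteq> {}" and "finite (Basis :: hyp set)"
    by (simp_all add: Basis_hyp_def)
  show "inner u v = (if u = v then 1 else 0)" if "u \<in> Basis" "v \<in> Basis" for u v :: hyp
    using that unfolding Basis_hyp_def
    by (elim insertE emptyE)
      (simp_all add: inner_hyp_def hi_def hj_def hk_def one_hyp_def)
  show "(\<forall>u\<in>Basis. inner w u = 0) \<longleftrightarrow> w = 0" for w :: hyp
    by (cases w) (simp add: Basis_hyp_def inner_hyp_def hi_def hj_def hk_def zero_hyp_def)
qed

end

definition hyp_seminorm :: "hyp \<Rightarrow> real" where
  "hyp_seminorm w = sqrt ((hx1 w)\<^sup>2 + (hx2 w)\<^sup>2)"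

definition hyp_topology :: "hyp topology" where
  "hyp_topology = topology_generated_by
     {B. \<exists>p r. r > 0 \<and> B = {w. hyp_seminorm (w - p) < r}}"

definition R_differentiable :: "hyp set \<Rightarrow> (hyp \<Rightarrow> hyp) set" where
  "R_differentiable U = {f. \<forall>w\<in>U. f differentiable (at w)}"

text \<open>Partial derivative in the direction \<open>e\<close>; the directions \<open>1, hi, hj, hk\<close> give
  the derivatives with respect to the coordinates \<open>hx1, hx2, hx3, hx4\<close>.\<close>

definition partial :: "hyp \<Rightarrow> (hyp \<Rightarrow> hyp) \<Rightarrow> hyp \<Rightarrow> hyp" where
  "partial e f w = vector_derivative (\<lambda>t. f (w + t *\<^sub>R e)) (at 0)"

definition nabla0 :: "(hyp \<Rightarrow> hyp) \<Rightarrow> hyp \<Rightarrow> hyp" where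
  "nabla0 f w = partial 1 f w + hi * partial hi f w + hj * partial hj f w + hk * partial hk f w"

definition left_regular :: "hyp set \<Rightarrow> (hyp \<Rightarrow> hyp) \<Rightarrow> bool" where
  "left_regular U f \<longleftrightarrow> f \<in> R_differentiable U \<and> (\<forall>w\<in>U. nabla0 f w = 0)"

definition R_analytic_at :: "(hyp \<Rightarrow> hyp) \<Rightarrow> hyp \<Rightarrow> bool" where
  "R_analytic_at f p \<longleftrightarrow> (\<exists>c :: nat \<times> nat \<times> nat \<times> nat \<Rightarrow> hyp. \<forall>\<^sub>F w in nhds p.
     ((\<lambda>(a, b, m, n). (hx1 (w - p) ^ a * hx2 (w - p) ^ b * hx3 (w - p) ^ m * hx4 (w - p) ^ n)
         *\<^sub>R c (a, b, m, n)) has_sum f w) UNIV)"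

definition symprod :: "(hyp \<Rightarrow> hyp) list \<Rightarrow> hyp \<Rightarrow> hyp" where
  "symprod fs w = (1 / fact (length fs)) *\<^sub>R
     (\<Sum>\<sigma> | \<sigma> permutes {..<length fs}. prod_list (map (\<lambda>m. (fs ! \<sigma> m) w) [0..<length fs]))"

definition eta2 :: "hyp \<Rightarrow> hyp" where "eta2 w = hx2 w *\<^sub>R 1 - hx1 w *\<^sub>R hi"
definition eta3 :: "hyp \<Rightarrow> hyp" where "eta3 w = hx3 w *\<^sub>R 1 - hx1 w *\<^sub>R hj"
definition eta4 :: "hyp \<Rightarrow> hyp" where "eta4 w = hx4 w *\<^sub>R 1 - hx1 w *\<^sub>R hk"

fun eta_pow :: "nat \<times> nat \<times> nat \<Rightarrow> hyp \<Rightarrow> hyp" where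
  "eta_pow (n1, n2, n3) w = (1 / (fact n1 * fact n2 * fact n3)) *\<^sub>R
     symprod (replicate n1 eta2 @ replicate n2 eta3 @ replicate n3 eta4) w"

text \<open>Since \<open>eta_pow n\<close> restricts to \<open>hx2 ^ n1 * hx3 ^ n2 * hx4 ^ n3 / (n1! n2! n3!)\<close> on the
  hyperplane \<open>hx1 = 0\<close>, its coefficient in a Taylor-type expansion is the plain derivative
  at 0; a further factor \<open>1 / (n1! n2! n3!)\<close> here would count the factorials twice.\<close>

fun eta_coeff :: "(hyp \<Rightarrow> hyp) \<Rightarrow> nat \<times> nat \<times> nat \<Rightarrow> hyp" where
  "eta_coeff f (n1, n2, n3) =
     (partial hi ^^ n1) ((partial hj ^^ n2) ((partial hk ^^ n3) f)) 0"

text \<open>The index \<open>(0, 0, 0)\<close> is left out of the sum because its term is \<open>f 0\<close>.\<close>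

definition eta_expansion_at :: "(hyp \<Rightarrow> hyp) \<Rightarrow> hyp \<Rightarrow> bool" where
  "eta_expansion_at f w \<longleftrightarrow>
     (\<lambda>n. eta_pow n w * eta_coeff f n) summable_on (- {(0, 0, 0)}) \<and>
     f w = f 0 + (\<Sum>\<^sub>\<infinity>n\<in>- {(0, 0, 0)}. eta_pow n w * eta_coeff f n)"

end

theory Submission
  imports Defs "HOL-Complex_Analysis.Conformal_Mappings"
begin

text \<open>Splitting an element as \<open>z + v j\<^sub>0\<close> with complex \<open>z\<close> and \<open>v\<close>, the generating function
  \<open>exp (t\<^sub>2 \<eta>\<^sub>2 + t\<^sub>3 \<eta>\<^sub>3 + t\<^sub>4 \<eta>\<^sub>4)\<close> gives the powers \<open>\<eta>\<^sup>n\<close> in closed form. In this form the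
  derivative of \<open>\<eta>\<^sup>n\<close> in direction \<open>x\<^sub>i\<close>, for \<open>i = 2, 3, 4\<close>, is \<open>\<eta>\<close> with one exponent lowered, and
  \<open>\<eta>\<^sup>n\<close> is regular. The complex part of the series is a power series in \<open>x\<^sub>2 - x\<^sub>1 i, x\<^sub>3, x\<^sub>4\<close>; so
  summability on an open set already yields a convergent majorant around each of its points,
  the series may be differentiated termwise, and its sum is regular.

  Conversely, a regular \<open>f\<close> and its series agree on the hyperplane \<open>x\<^sub>1 = 0\<close>. The difference is
  regular and vanishes there; its complex part is holomorphic in \<open>x\<^sub>1 + i x\<^sub>2\<close>, hence zero, and
  then its nilpotent part is holomorphic, hence zero as well. Regularity spreads from a
  neighbourhood of 0 to \<open>U\<close> by the identity theorem for the real analytic function \<open>nabla0 f\<close>.\<close>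

subsection \<open>Termwise differentiation\<close>

text \<open>The closed form rests on
  \<open>J = t\<^sub>2 i + t\<^sub>3 j\<^sub>0 + t\<^sub>4 k\<^sub>0\<close>: \<open>i\<close>
  anticommutes with \<open>j\<^sub>0\<close> and \<open>k\<^sub>0\<close>, and products of the
  latter two vanish, so \<open>J\<close> squares to \<open>- t\<^sub>2\<^sup>2\<close>. The exponent
  is the real number \<open>s = t\<^sub>2 x\<^sub>2 + t\<^sub>3 x\<^sub>3 + t\<^sub>4
  x\<^sub>4\<close> minus \<open>x\<^sub>1 J\<close>, and its exponential is \<open>exp s\<close>
  times \<open>cos (t\<^sub>2 x\<^sub>1) - J sin (t\<^sub>2 x\<^sub>1) / t\<^sub>2\<close>.
  Differentiation in \<open>x\<^sub>1\<close> multiplies it by \<open>- J\<close>, which is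
  regularity. Exponentials do not occur in the proof itself: the coefficients are verified through
  the recursion that expresses the derivative of \<open>exp (\<lambda> S)\<close> in \<lambda> as
  \<open>exp (\<lambda> S) S\<close>. Zero divisors are the obstacle in passing from summability to
  a majorant: the size of a product does not control its factors. Only the complex part is
  multiplicative in absolute value, so coefficients must be bounded through it.\<close>

lemma has_derivative_infsum:
  fixes F :: "'i \<Rightarrow> 'a::{real_normed_vector, perfect_space} \<Rightarrow> 'b::banach"
  assumes S: "open S" "convex S" "x \<in> S"
    and D: "\<And>n y. n \<in> I \<Longrightarrow> y \<in> S \<Longrightarrow> (F n has_derivative F' n y) (at y)"
    and B: "\<And>n y h. n \<in> I \<Longrightarrow> y \<in> S \<Longrightarrow> norm (F' n y h) \<le> M n * norm h"
    and M: "M summable_on I"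
    and g: "\<And>y. y \<in> S \<Longrightarrow> ((\<lambda>n. F n y) has_sum g y) I"
  shows "(g has_derivative (\<lambda>h. \<Sum>\<^sub>\<infinity>n\<in>I. F' n x h)) (at x)"
    and "(\<lambda>n. F' n x h) summable_on I"
proof -
  have Mh: "(\<lambda>n. M n * norm h) summable_on J" if "J \<subseteq> I" for h J
    using summable_on_cmult_left[OF summable_on_subset_banach[OF M that], of "norm h"] .
  have lin: "bounded_linear (F' n x)" if "n \<in> I" for n
    using D[OF that S(3)] by (rule has_derivative_bounded_linear)
  have ab: "(\<lambda>n. norm (F' n x h)) summable_on J" if "J \<subseteq> I" for h J
    by (rule Infinite_Sum.abs_summable_on_comparison_test'[OF Mh[OF that]]) (use B S that in auto)
  have su: "(\<lambda>n. F' n x h) summable_on J" if "J \<subseteq> I" for h J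
    by (rule abs_summable_summable[OF ab[OF that]])
  show "(\<lambda>n. F' n x h) summable_on I" by (rule su) simp
  have bl: "bounded_linear (\<lambda>h. \<Sum>\<^sub>\<infinity>n\<in>I. F' n x h)"
  proof (rule bounded_linear_intro)
    fix h k :: 'a and r :: real
    have "(\<Sum>\<^sub>\<infinity>n\<in>I. F' n x (h + k)) = (\<Sum>\<^sub>\<infinity>n\<in>I. F' n x h + F' n x k)"
      by (rule infsum_cong) (simp add: lin linear_add bounded_linear.linear)
    also have "\<dots> = (\<Sum>\<^sub>\<infinity>n\<in>I. F' n x h) + (\<Sum>\<^sub>\<infinity>n\<in>I. F' n x k)"
      by (rule infsum_add) (auto intro: su)
    finally show "(\<Sum>\<^sub>\<infinity>n\<in>I. F' n x (h + k)) = (\<Sum>\<^sub>\<infinity>n\<in>I. F' n x h) + (\<Sum>\<^sub>\<infinity>n\<in>I. F' n x k)" .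
    have "(\<Sum>\<^sub>\<infinity>n\<in>I. F' n x (r *\<^sub>R h)) = (\<Sum>\<^sub>\<infinity>n\<in>I. r *\<^sub>R F' n x h)"
      by (rule infsum_cong) (simp add: lin linear_scale bounded_linear.linear)
    thus "(\<Sum>\<^sub>\<infinity>n\<in>I. F' n x (r *\<^sub>R h)) = r *\<^sub>R (\<Sum>\<^sub>\<infinity>n\<in>I. F' n x h)"
      by (simp add: infsum_scaleR_right)
    have "norm (\<Sum>\<^sub>\<infinity>n\<in>I. F' n x h) \<le> (\<Sum>\<^sub>\<infinity>n\<in>I. M n * norm h)"
      by (rule norm_infsum_le[OF has_sum_infsum has_sum_infsum]) (use su Mh B S in auto)
    thus "norm (\<Sum>\<^sub>\<infinity>n\<in>I. F' n x h) \<le> norm h * (\<Sum>\<^sub>\<infinity>n\<in>I. M n)"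
      using infsum_cmult_left[of "norm h" M I] M by (simp add: mult.commute)
  qed
  show "(g has_derivative (\<lambda>h. \<Sum>\<^sub>\<infinity>n\<in>I. F' n x h)) (at x)"
    unfolding has_derivative_at_alt
  proof (intro conjI allI impI bl)
    fix e :: real assume e: "e > 0"
    \<comment> \<open>Each remainder is at most twice \<open>M n\<close> times the distance, so a
      tail of \<open>M\<close> below \<open>e / 4\<close> costs \<open>e / 2\<close>; the finitely
      many terms in \<open>J\<close> supply the other half by their own differentiability.\<close>
    have "\<exists>J. finite J \<and> J \<subseteq> I \<and> dist (sum M J) (infsum M I) \<le> e / 4"
      using has_sum_finite_approximation[OF has_sum_infsum[OF M], of "e/4"] e by auto
    then obtain J where J: "finite J" "J \<subseteq> I" "dist (sum M J) (infsum M I) \<le> e / 4" by blast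
    have spl: "infsum f I = sum f J + infsum f (I - J)" if "f summable_on I" for f :: "'i \<Rightarrow> 'c::banach"
    proof -
      have "infsum f (J \<union> (I - J)) = infsum f J + infsum f (I - J)"
        by (rule infsum_Un_disjoint) (use J that summable_on_subset_banach[OF that, of "I - J"] in auto)
      moreover have "J \<union> (I - J) = I" using J by auto
      ultimately show ?thesis using J by simp
    qed
    have tail: "infsum M (I - J) \<le> e / 4"
      using spl[OF M] J(3) by (simp add: dist_real_def)
    have "((\<lambda>y. \<Sum>n\<in>J. F n y) has_derivative (\<lambda>h. \<Sum>n\<in>J. F' n x h)) (at x)"
      by (intro has_derivative_sum D S) (use J in auto)
    then obtain d1 where d1: "d1 > 0" "\<And>y. norm (y - x) < d1 \<Longrightarrow>
        norm ((\<Sum>n\<in>J. F n y) - (\<Sum>n\<in>J. F n x) - (\<Sum>n\<in>J. F' n x (y - x))) \<le> e / 2 * norm (y - x)"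
      unfolding has_derivative_at_alt using e by (meson half_gt_zero)
    obtain d2 where d2: "d2 > 0" "ball x d2 \<subseteq> S"
      using S open_contains_ball by blast
    have "norm (g y - g x - (\<Sum>\<^sub>\<infinity>n\<in>I. F' n x (y - x))) \<le> e * norm (y - x)"
      if y: "norm (y - x) < min d1 d2" for y
    proof -
      have yS: "y \<in> S" using d2 y by (auto simp: subset_iff dist_norm norm_minus_commute)
      define H where "H n = F n y - F n x - F' n x (y - x)" for n
      have Hs: "(H has_sum (g y - g x - (\<Sum>\<^sub>\<infinity>n\<in>I. F' n x (y - x)))) I"
        unfolding H_def diff_conv_add_uminus
        by (intro has_sum_add g yS) (auto simp: has_sum_uminus intro!: g S has_sum_infsum su)
      \<comment> \<open>A difference of values minus a linear term: the mean value inequality on the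
        convex set bounds the former, the hypothesis the latter, whence the factor 2.\<close>
      have HB: "norm (H n) \<le> 2 * (M n * norm (y - x))" if n: "n \<in> I" for n
      proof -
        have "norm (F n y - F n x) \<le> M n * norm (y - x)"
        proof (rule differentiable_bound[OF S(2)])
          fix z assume z: "z \<in> S"
          show "(F n has_derivative F' n z) (at z within S)"
            using D[OF n z] has_derivative_at_withinI by blast
          show "onorm (F' n z) \<le> M n"
            by (rule onorm_le) (use B n z in auto)
        qed (use yS S in auto)
        moreover have "norm (F' n x (y - x)) \<le> M n * norm (y - x)" using B n S by auto
        ultimately show ?thesis unfolding H_def
          by (smt (verit) norm_triangle_ineq4)
      qed
      have "norm (infsum H (I - J)) \<le> (\<Sum>\<^sub>\<infinity>n\<in>I - J. 2 * (M n * norm (y - x)))"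
      proof (rule norm_infsum_le[OF has_sum_infsum has_sum_infsum])
        show "H summable_on I - J"
          using Hs summable_on_subset_banach[of H I "I - J"] by (auto simp: summable_on_def)
        show "(\<lambda>n. 2 * (M n * norm (y - x))) summable_on I - J"
          by (intro summable_on_cmult_right Mh) auto
      qed (use HB in auto)
      also have "\<dots> = 2 * (infsum M (I - J) * norm (y - x))"
        using summable_on_subset_banach[OF M, of "I - J"]
        by (simp add: infsum_cmult_right infsum_cmult_left Mh)
      also have "\<dots> \<le> 2 * (e / 4 * norm (y - x))"
        using tail by (intro mult_left_mono mult_right_mono) auto
      finally have t: "norm (infsum H (I - J)) \<le> e / 2 * norm (y - x)" by simp
      have "g y - g x - (\<Sum>\<^sub>\<infinity>n\<in>I. F' n x (y - x)) = infsum H I"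
        using Hs by (simp add: infsumI)
      also have "\<dots> = sum H J + infsum H (I - J)" using Hs by (intro spl) (auto simp: summable_on_def)
      finally have eq: "g y - g x - (\<Sum>\<^sub>\<infinity>n\<in>I. F' n x (y - x)) = sum H J + infsum H (I - J)" .
      have "norm (sum H J) \<le> e / 2 * norm (y - x)"
        using d1(2)[of y] y unfolding H_def by (simp add: sum_subtractf)
      thus ?thesis unfolding eq using t norm_triangle_ineq[of "sum H J" "infsum H (I - J)"] by linarith
    qed
    thus "\<exists>d>0. \<forall>y. norm (y - x) < d \<longrightarrow>
        norm (g y - g x - (\<Sum>\<^sub>\<infinity>n\<in>I. F' n x (y - x))) \<le> e * norm (y - x)"
      using d1 d2 by (intro exI[of _ "min d1 d2"]) auto
  qed
qed

subsection \<open>Complex coordinates\<close>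

definition cpart :: "hyp \<Rightarrow> complex" where "cpart w = Complex (hx1 w) (hx2 w)"
definition npart :: "hyp \<Rightarrow> complex" where "npart w = Complex (hx3 w) (hx4 w)"
text \<open>The \<open>j\<close>-th derivative of the divided power \<open>x ^ k / fact k\<close>.
  The case \<open>k < j\<close> is separate because truncated subtraction would give 1 instead of
  0.\<close>

definition dpow :: "nat \<Rightarrow> nat \<Rightarrow> 'a::real_normed_field \<Rightarrow> 'a" where
  "dpow j k x = (if k < j then 0 else x ^ (k - j) / fact (k - j))"
text \<open>The conjugate of \<open>x\<^sub>2 - x\<^sub>1 i\<close>, the value of
  \<open>eta2\<close>, so that its imaginary part is \<open>x\<^sub>1\<close> with a positive
  sign.\<close>

definition zeta :: "hyp \<Rightarrow> complex" where "zeta w = Complex (hx2 w) (hx1 w)"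
text \<open>\<open>etaD p q s n\<close> is the divided power \<open>\<eta>\<^sup>n\<close> with the exponent \<open>n\<close> lowered by \<open>(p, q, s)\<close> (and \<open>0\<close>
  where that is impossible). The index of the \<open>zeta\<close>-factor is shifted by one because the
  nilpotent part is a multiple of \<open>Im (zeta w ^ (a + 1)) / (a + 1)!\<close>, the coefficient of
  \<open>t\<^sub>2\<^sup>a\<close> in \<open>exp (t\<^sub>2 x\<^sub>2) sin (t\<^sub>2 x\<^sub>1) / t\<^sub>2\<close>.\<close>

definition etaD :: "nat \<Rightarrow> nat \<Rightarrow> nat \<Rightarrow> nat \<times> nat \<times> nat \<Rightarrow> hyp \<Rightarrow> hyp" where
  "etaD p q s n w = (case n of (a, b, c) \<Rightarrow>
     let u = dpow (Suc p) (Suc a) (zeta w); v = Im (dpow p (Suc a) (zeta w));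
         X = (\<lambda>i. dpow i b (hx3 w)); Y = (\<lambda>i. dpow i c (hx4 w))
     in Hyp (Re u * (X q * Y s)) (- Im u * (X q * Y s))
         (- v * (X (Suc q) * Y s)) (- v * (X q * Y (Suc s))))"

lemma hyp_eq_parts: "v = w \<longleftrightarrow> cpart v = cpart w \<and> npart v = npart w"
  by (auto simp: hyp_eq_iff cpart_def npart_def)

text \<open>From \<open>hi * hj = hk\<close>, an element is \<open>z + v hj\<close> with complex
  \<open>z\<close> and \<open>v\<close>. Moving \<open>hj\<close> to the right past a complex number
  conjugates that number, which explains \<open>cnj\<close>; \<open>hj * hj = 0\<close> makes
  \<open>cpart\<close> multiplicative.\<close>

lemma part_simps [simp]:
  "cpart (v + w) = cpart v + cpart w" "npart (v + w) = npart v + npart w"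
  "cpart (v * w) = cpart v * cpart w"
  "npart (v * w) = cpart v * npart w + npart v * cnj (cpart w)"
  "cpart (r *\<^sub>R w) = r *\<^sub>R cpart w" "npart (r *\<^sub>R w) = r *\<^sub>R npart w"
  by (simp_all add: cpart_def npart_def complex_eq_iff hyp_ops_defs algebra_simps)

lemma norm_hyp_le_parts: "norm w \<le> norm (cpart w) + norm (npart w)"
proof -
  have "norm w = sqrt ((norm (cpart w))\<^sup>2 + (norm (npart w))\<^sup>2)"
    by (simp add: norm_hyp_def inner_hyp_def cpart_def npart_def cmod_def power2_eq_square)
  thus ?thesis
    by (metis norm_ge_zero sqrt_sum_squares_le_sum)
qed

lemma norm_cpart_le: "norm (cpart w) \<le> norm w"
  and norm_npart_le: "norm (npart w) \<le> norm w"
  by (simp_all add: norm_hyp_def inner_hyp_def cpart_def npart_def cmod_def power2_eq_square)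

text \<open>The Euclidean norm is not submultiplicative: \<open>1 + hj\<close> has squared norm 2,
  but its square has norm \<open>sqrt 5\<close>. The constant 3 counts the complex products that
  make up \<open>v * w\<close>.\<close>

lemma norm_hyp_mult_le: "norm (v * w) \<le> 3 * (norm v * norm (w::hyp))"
proof -
  have "norm (v * w) \<le> norm (cpart v * cpart w) +
      (norm (cpart v * npart w) + norm (npart v * cnj (cpart w)))"
    using norm_hyp_le_parts[of "v * w"] norm_triangle_ineq[of "cpart v * npart w" "npart v * cnj (cpart w)"]
    by simp
  also have "\<dots> \<le> norm v * norm w + (norm v * norm w + norm v * norm w)"
    unfolding norm_mult complex_mod_cnj
    by (intro add_mono mult_mono norm_cpart_le norm_npart_le) auto
  finally show ?thesis by simp
qed

lemma dpow_Suc_Suc [simp]: "dpow (Suc j) (Suc k) x = dpow j k x"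
  by (simp add: dpow_def)

lemma dpow_0_0 [simp]: "dpow 0 0 x = 1" by (simp add: dpow_def)

lemma dpow_Suc_0 [simp]: "dpow (Suc j) 0 x = 0" by (simp add: dpow_def)

lemma norm_dpow: "norm (dpow j k x) = dpow j k (norm x)"
  by (simp add: dpow_def norm_divide norm_power)

lemma dpow_nonneg: "0 \<le> x \<Longrightarrow> 0 \<le> dpow j k (x::real)"
  by (simp add: dpow_def)

lemma dpow_mono: "0 \<le> x \<Longrightarrow> x \<le> y \<Longrightarrow> dpow j k x \<le> dpow j k (y::real)"
  by (auto simp: dpow_def intro!: divide_right_mono power_mono)

text \<open>Euler's relation for a homogeneous function of degree \<open>k - j\<close>; for
  \<open>k \<le> j\<close> both sides vanish.\<close>

lemma dpow_Suc_times: "x * dpow (Suc j) k x = of_nat (k - j) * dpow j k x"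
proof (cases "k - j")
  case 0
  thus ?thesis by (simp add: dpow_def)
next
  case (Suc m)
  hence "k - Suc j = m" by simp
  thus ?thesis using Suc by (auto simp: dpow_def field_simps simp del: of_nat_Suc)
qed

lemma has_field_derivative_dpow:
  fixes x :: "'a::real_normed_field"
  shows   "(dpow j k has_field_derivative dpow (Suc j) k x) (at x)"
proof (cases "k \<le> j")
  case True
  have "dpow j k = (\<lambda>x. if k < j then 0 else 1)" "dpow (Suc j) k x = 0"
    using True by (auto simp: dpow_def fun_eq_iff)
  have "(dpow j k has_field_derivative 0) (at x)"
    unfolding \<open>dpow j k = _\<close> by (rule DERIV_const)
  thus ?thesis using \<open>dpow (Suc j) k x = 0\<close> by simp
next
  case False
  then obtain m where m: "k - j = Suc m" "k - Suc j = m" "\<not> k < j" "\<not> k < Suc j"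
    by (metis Suc_diff_Suc less_Suc_eq_le linorder_not_less not_less_eq_eq less_imp_le)
  have "((\<lambda>x. x ^ Suc m / fact (Suc m)) has_field_derivative
      (1 + of_nat m) * (1 * x ^ m) / fact (Suc m)) (at x)"
    by (intro DERIV_cdivide DERIV_power_Suc DERIV_ident)
  moreover have "(1 + of_nat m) * (1 * x ^ m) / fact (Suc m) = x ^ m / (fact m :: 'a)"
    using of_nat_neq_0[of m, where 'a='a] by simp
  moreover have "dpow j k = (\<lambda>x::'a. x ^ Suc m / fact (Suc m))" "dpow (Suc j) k x = x ^ m / fact m"
    using m by (auto simp: dpow_def[abs_def])
  ultimately show ?thesis by (simp only:)
qed

text \<open>A Cauchy-type estimate: enlarging the radius absorbs derivatives, with a constant
  independent of the exponent \<open>k\<close>.\<close>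

lemma dpow_le_dpow:
  fixes r R :: real
  assumes "0 \<le> r" "r < R"
  shows "\<exists>C\<ge>0. \<forall>k. dpow j k r \<le> C * dpow 0 k R"
  using assms
proof (induction j arbitrary: r)
  case 0
  show ?case by (rule exI[of _ 1]) (use 0 in \<open>auto intro: dpow_mono\<close>)
next
  case (Suc j)
  \<comment> \<open>One derivative is absorbed between \<open>r\<close> and the midpoint
    \<open>s\<close>; the induction hypothesis absorbs the other \<open>j\<close> between
    \<open>s\<close> and \<open>R\<close>.\<close>
  define s where "s = (r + R) / 2"
  have s: "0 < s" "r < s" "s < R" using Suc.prems by (auto simp: s_def)
  obtain C where C: "C \<ge> 0" "\<And>k. dpow j k s \<le> C * dpow 0 k R"
    using Suc.IH[of s] s by auto
  have "(\<lambda>n. of_nat n * (r / s) ^ n) \<longlonglongrightarrow> 0"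
    by (rule powser_times_n_limit_0) (use s Suc.prems in auto)
  hence "Bseq (\<lambda>n. of_nat n * (r / s) ^ n)" by (simp add: convergent_imp_Bseq convergentI)
  then obtain K where K: "K > 0" "\<And>n. norm (of_nat n * (r / s) ^ n) \<le> K"
    by (auto simp: Bseq_def)
  have "dpow (Suc j) k r \<le> (K + 1) / s * dpow j k s" for k
  proof (cases "k - j")
    case 0
    hence "dpow (Suc j) k r = 0" by (auto simp: dpow_def)
    thus ?thesis using K s dpow_nonneg[of s j k] by simp
  next
    case (Suc m)
    hence m: "k - Suc j = m" "\<not> k < j" "\<not> k < Suc j" by auto
    \<comment> \<open>\<open>K\<close> bounds \<open>m * (r / s) ^ m\<close>; the extra 1 pays for
      the exponent being one less than the factor \<open>Suc m\<close>.\<close>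
    have "real (Suc m) * (r / s) ^ m \<le> K + 1"
    proof -
      have "real m * (r / s) ^ m \<le> K" using K(2)[of m] by simp
      moreover have "(r / s) ^ m \<le> 1" using s Suc.prems by (intro power_le_one) auto
      ultimately show ?thesis by (simp add: algebra_simps)
    qed
    hence "real (Suc m) * r ^ m \<le> (K + 1) * s ^ m"
      using s by (simp add: power_divide field_simps del: of_nat_Suc)
    hence "r ^ m / fact m \<le> (K + 1) * s ^ m / fact (Suc m)"
      by (simp add: field_simps del: of_nat_Suc)
    moreover have "(K + 1) / s * dpow j k s = (K + 1) * s ^ m / fact (Suc m)"
      using m Suc s by (simp add: dpow_def del: fact_Suc)
    ultimately show ?thesis using m by (simp add: dpow_def del: fact_Suc)
  qed
  also have "(K + 1) / s * dpow j k s \<le> (K + 1) / s * (C * dpow 0 k R)" for k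
    using C K s by (intro mult_left_mono) auto
  finally have "\<And>k. dpow (Suc j) k r \<le> ((K + 1) / s * C) * dpow 0 k R" by (simp add: mult.assoc)
  thus ?case using C K s by (intro exI[of _ "(K + 1) / s * C"]) auto
qed

lemma cpart_etaD: "cpart (etaD p q s (a, b, c) w) =
    cnj (dpow (Suc p) (Suc a) (zeta w)) * of_real (dpow q b (hx3 w) * dpow s c (hx4 w))"
  and npart_etaD: "npart (etaD p q s (a, b, c) w) =
    - of_real (Im (dpow p (Suc a) (zeta w))) *
      Complex (dpow (Suc q) b (hx3 w) * dpow s c (hx4 w)) (dpow q b (hx3 w) * dpow (Suc s) c (hx4 w))"
  by (simp_all add: etaD_def cpart_def npart_def complex_eq_iff Let_def)

lemma eta_parts:
  "cpart (eta2 w) = cnj (zeta w)" "npart (eta2 w) = 0"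
  "cpart (eta3 w) = of_real (hx3 w)" "npart (eta3 w) = - of_real (hx1 w)"
  "cpart (eta4 w) = of_real (hx4 w)" "npart (eta4 w) = - \<i> * of_real (hx1 w)"
  by (simp_all add: eta2_def eta3_def eta4_def cpart_def npart_def zeta_def hi_def hj_def hk_def
      complex_eq_iff)

text \<open>Coefficient form of the derivative of \<open>exp (\<lambda> S)\<close> in \<lambda>,
  with \<open>S = t\<^sub>2 \<eta>\<^sub>2 + t\<^sub>3 \<eta>\<^sub>3 + t\<^sub>4
  \<eta>\<^sub>4\<close>: Euler's relation for a homogeneous function of degree
  \<open>a + b + c\<close>, with the factors on the right because the algebra is
  noncommutative.\<close>

lemma etaD_rec:
  "etaD 1 0 0 (a, b, c) w * eta2 w + etaD 0 1 0 (a, b, c) w * eta3 w + etaD 0 0 1 (a, b, c) w * eta4 w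
    = real (a + b + c) *\<^sub>R etaD 0 0 0 (a, b, c) w"
proof -
  define z x y where "z = zeta w" and "x = hx3 w" and "y = hx4 w"
  define Z0 Z1 Z2 where "Z0 = dpow 0 (Suc a) z" and "Z1 = dpow 0 a z" and "Z2 = dpow 1 a z"
  define X0 X1 X2 where "X0 = dpow 0 b x" and "X1 = dpow 1 b x" and "X2 = dpow 2 b x"
  define Y0 Y1 Y2 where "Y0 = dpow 0 c y" and "Y1 = dpow 1 c y" and "Y2 = dpow 2 c y"
  have Z: "z * Z2 = of_nat a * Z1" "z * Z1 = of_nat (Suc a) * Z0"
    unfolding Z0_def Z1_def Z2_def using dpow_Suc_times[of z 0 a] dpow_Suc_times[of z 0 "Suc a"] by simp_all
  \<comment> \<open>The subtraction \<open>real b - 1\<close> is the real one; for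
    \<open>b = 0\<close> both \<open>X1\<close> and \<open>X2\<close> are 0.\<close>
  have X: "x * X1 = real b * X0" "x * X2 = (real b - 1) * X1"
    unfolding X0_def X1_def X2_def using dpow_Suc_times[of x 0 b] dpow_Suc_times[of x 1 b]
    by (cases b; simp add: numeral_2_eq_2)+
  have Y: "y * Y1 = real c * Y0" "y * Y2 = (real c - 1) * Y1"
    unfolding Y0_def Y1_def Y2_def using dpow_Suc_times[of y 0 c] dpow_Suc_times[of y 1 c]
    by (cases c; simp add: numeral_2_eq_2)+
  have x1: "hx1 w = Im z" by (simp add: z_def zeta_def)
  have C: "cnj Z2 * cnj z = of_nat a * cnj Z1"
    by (metis Z(1) complex_cnj_mult complex_cnj_of_nat mult.commute)
  \<comment> \<open>In the nilpotent part the shifted index yields the weight \<open>a + 1\<close>.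
    It is offset by \<open>b - 1\<close> or \<open>c - 1\<close> from the second derivative
    \<open>X2\<close> or \<open>Y2\<close>, so the weights again add up to
    \<open>a + b + c\<close>.\<close>
  have N: "Im Z1 * Re z + Re Z1 * Im z = (real a + 1) * Im Z0"
    using arg_cong[OF Z(2), of Im] by (simp add: algebra_simps)
  have E: "cpart (etaD 1 0 0 (a, b, c) w) = cnj Z2 * of_real (X0 * Y0)"
    "cpart (etaD 0 1 0 (a, b, c) w) = cnj Z1 * of_real (X1 * Y0)"
    "cpart (etaD 0 0 1 (a, b, c) w) = cnj Z1 * of_real (X0 * Y1)"
    "cpart (etaD 0 0 0 (a, b, c) w) = cnj Z1 * of_real (X0 * Y0)"
    "npart (etaD 1 0 0 (a, b, c) w) = - of_real (Im Z1) * Complex (X1 * Y0) (X0 * Y1)"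
    "npart (etaD 0 1 0 (a, b, c) w) = - of_real (Im Z0) * Complex (X2 * Y0) (X1 * Y1)"
    "npart (etaD 0 0 1 (a, b, c) w) = - of_real (Im Z0) * Complex (X1 * Y1) (X0 * Y2)"
    "npart (etaD 0 0 0 (a, b, c) w) = - of_real (Im Z0) * Complex (X1 * Y0) (X0 * Y1)"
    by (simp_all add: cpart_etaD npart_etaD Z0_def Z1_def Z2_def X0_def X1_def X2_def
        Y0_def Y1_def Y2_def z_def x_def y_def numeral_2_eq_2)
  have H: "cpart (eta2 w) = cnj z" "npart (eta2 w) = 0" "cpart (eta3 w) = of_real x"
    "npart (eta3 w) = - of_real (Im z)" "cpart (eta4 w) = of_real y" "npart (eta4 w) = - \<i> * of_real (Im z)"
    using eta_parts[of w] x1 by (simp_all add: z_def x_def y_def)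
  show ?thesis
    unfolding hyp_eq_parts part_simps E H
  proof
    have "cnj Z2 * of_real (X0 * Y0) * cnj z + cnj Z1 * of_real (X1 * Y0) * of_real x +
        cnj Z1 * of_real (X0 * Y1) * of_real y =
      (cnj Z2 * cnj z) * of_real (X0 * Y0) + cnj Z1 * of_real ((x * X1) * Y0 + X0 * (y * Y1))"
      by (simp add: algebra_simps)
    also have "\<dots> = real (a + b + c) *\<^sub>R (cnj Z1 * of_real (X0 * Y0))"
      unfolding C X Y by (simp add: algebra_simps scaleR_conv_of_real)
    finally show "cnj Z2 * of_real (X0 * Y0) * cnj z + cnj Z1 * of_real (X1 * Y0) * of_real x +
        cnj Z1 * of_real (X0 * Y1) * of_real y = real (a + b + c) *\<^sub>R (cnj Z1 * of_real (X0 * Y0))" .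
  qed (simp add: complex_eq_iff; use X Y N in algebra)
qed

subsection \<open>Closed form of the symmetrized powers\<close>

lemma count_list_eq_count: "count_list xs x = count (mset xs) x"
  by (induction xs) auto

lemma sum_list_map_eq_sum_count_scaleR:
  fixes f :: "'b \<Rightarrow> 'a::real_vector"
  assumes "finite X" "set xs \<subseteq> X"
  shows "(\<Sum>x\<leftarrow>xs. f x) = (\<Sum>x\<in>X. real (count_list xs x) *\<^sub>R f x)"
  using assms(2)
proof (induction xs)
  case (Cons y xs)
  have "(\<Sum>x\<in>X. real (count_list (y # xs) x) *\<^sub>R f x) =
      (\<Sum>x\<in>X. (if y = x then f x else 0) + real (count_list xs x) *\<^sub>R f x)"
    by (intro sum.cong) (auto simp: scaleR_add_left)
  also have "\<dots> = f y + (\<Sum>x\<in>X. real (count_list xs x) *\<^sub>R f x)"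
    using Cons.prems assms(1) by (simp add: sum.distrib sum.delta')
  finally show ?case using Cons by simp
qed simp

definition perm_sum :: "'a::real_algebra_1 list \<Rightarrow> 'a" where
  "perm_sum xs = (\<Sum>\<sigma> | \<sigma> permutes {..<length xs}. prod_list (map (\<lambda>m. xs ! \<sigma> m) [0..<length xs]))"

text \<open>Permutations are sorted by the entry \<open>b\<close> placed last: each is a
  transposition of \<open>N\<close> and \<open>b\<close> after a permutation of the first
  \<open>N\<close> positions. Overwriting position \<open>b\<close> by the last entry and truncating
  leaves the other factors.\<close>

lemma perm_sum_Suc:
  assumes "length xs = Suc N"
  shows "perm_sum xs = (\<Sum>b<Suc N. perm_sum (take N (xs[b := xs ! N])) * xs ! b)"
proof -
  have "perm_sum xs = sum (\<lambda>\<sigma>. prod_list (map (\<lambda>m. xs ! \<sigma> m) [0..<Suc N])) {\<sigma>. \<sigma> permutes insert N {..<N}}"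
    unfolding perm_sum_def assms by (simp add: lessThan_Suc)
  also have "\<dots> = (\<Sum>b\<in>insert N {..<N}. \<Sum>q | q permutes {..<N}.
      prod_list (map (\<lambda>m. xs ! (Transposition.transpose N b \<circ> q) m) [0..<Suc N]))"
    by (rule sum_over_permutations_insert) auto
  also have "\<dots> = (\<Sum>b\<in>insert N {..<N}. \<Sum>q | q permutes {..<N}.
      prod_list (map (\<lambda>m. take N (xs[b := xs ! N]) ! q m) [0..<N]) * xs ! b)"
  proof (intro sum.cong refl)
    fix b q assume b: "b \<in> insert N {..<N}" and "q \<in> {q. q permutes {..<N}}"
    hence q: "q permutes {..<N}" by simp
    have qN: "q N = N" using q by (simp add: permutes_def)
    have "xs ! Transposition.transpose N b (q m) = take N (xs[b := xs ! N]) ! q m" if "m < N" for m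
    proof -
      have "q m < N" using permutes_in_image[OF q, of m] that by simp
      thus ?thesis using b assms by (auto simp: Transposition.transpose_def nth_list_update)
    qed
    hence M: "map (\<lambda>m. xs ! Transposition.transpose N b (q m)) [0..<N] = map (\<lambda>m. take N (xs[b := xs ! N]) ! q m) [0..<N]"
      by simp
    have "map (\<lambda>m. xs ! (Transposition.transpose N b \<circ> q) m) [0..<Suc N] =
        map (\<lambda>m. xs ! Transposition.transpose N b (q m)) [0..<N] @ [xs ! b]"
      by (simp add: qN)
    thus "prod_list (map (\<lambda>m. xs ! (Transposition.transpose N b \<circ> q) m) [0..<Suc N]) =
      prod_list (map (\<lambda>m. take N (xs[b := xs ! N]) ! q m) [0..<N]) * xs ! b"
      unfolding M by (simp del: map_eq_conv)
  qed
  also have "\<dots> = (\<Sum>b<Suc N. perm_sum (take N (xs[b := xs ! N])) * xs ! b)"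
    using assms by (simp add: perm_sum_def sum_distrib_right lessThan_Suc)
  finally show ?thesis .
qed

lemma mset_take_update:
  assumes "length xs = Suc N" "b < Suc N"
  shows "mset xs = add_mset (xs ! b) (mset (take N (xs[b := xs ! N])))"
proof -
  have "add_mset (xs ! N) (mset (take N (xs[b := xs ! N]))) = mset (xs[b := xs ! N])"
  proof -
    have "xs[b := xs ! N] = take N (xs[b := xs ! N]) @ [xs ! N]"
      using assms by (metis Suc_le_eq append_Nil2 length_list_update lessI nth_list_update
          drop_all le_refl append_take_drop_id take_Suc_conv_app_nth order_refl take_all)
    thus ?thesis by (metis add_mset_add_single mset.simps mset_append)
  qed
  also have "\<dots> = add_mset (xs ! N) (mset xs - {#xs ! b#})"
    using assms by (simp add: mset_update)
  finally show ?thesis using assms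
    by (metis Suc_le_eq add_mset_add_single add_right_cancel insert_DiffM nth_mem set_mset_mset)
qed

lemma etaD_shift:
  "etaD (Suc 0) 0 0 (Suc a, b, c) w = etaD 0 0 0 (a, b, c) w"
  "etaD 0 (Suc 0) 0 (a, Suc b, c) w = etaD 0 0 0 (a, b, c) w"
  "etaD 0 0 (Suc 0) (a, b, Suc c) w = etaD 0 0 0 (a, b, c) w"
  by (simp_all add: etaD_def)

text \<open>Induction on the last factor, with \<open>etaD_rec\<close> as the recursion. Factors are
  tracked by the labels 0, 1, 2 rather than by their values, because the values can coincide, as
  they do at \<open>w = 0\<close>, and the multiplicities would be lost.\<close>

lemma perm_sum_eq_etaD:
  fixes v :: "nat \<Rightarrow> hyp" and w :: hyp
  defines "v \<equiv> (\<lambda>i. if i = 0 then eta2 w else if i = 1 then eta3 w else eta4 w)"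
  assumes "set xs \<subseteq> {0, 1, 2}"
  shows "perm_sum (map v xs) =
    (fact (length xs) * (fact (count_list xs 0) * fact (count_list xs 1) * fact (count_list xs 2))) *\<^sub>R
      etaD 0 0 0 (count_list xs 0, count_list xs 1, count_list xs 2) w"
  using assms(2)
proof (induction "length xs" arbitrary: xs)
  case 0
  hence "etaD 0 0 0 (count_list xs 0, count_list xs 1, count_list xs 2) w = 1"
    by (simp add: hyp_eq_parts cpart_etaD npart_etaD) (simp add: cpart_def npart_def dpow_def complex_eq_iff zeta_def)
  moreover have "perm_sum (map v xs) = 1" using 0 by (simp add: perm_sum_def)
  ultimately show ?case using 0 by simp
next
  case (Suc N)
  define a b c where "a = count_list xs 0" and "b = count_list xs 1" and "c = count_list xs 2"
  define F :: real where "F = fact a * fact b * fact c"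
  define g where "g i = (if i = 0 then etaD 1 0 0 (a, b, c) w else if i = 1
    then etaD 0 1 0 (a, b, c) w else etaD 0 0 1 (a, b, c) w)" for i :: nat
  have N: "a + b + c = Suc N"
    using sum_count_set[OF Suc.prems] Suc.hyps(2) by (simp add: a_def b_def c_def)
  \<comment> \<open>Removing one factor with label \<open>i\<close> divides the product of
    factorials by the multiplicity of \<open>i\<close>; multiplying by that multiplicity restores
    \<open>F\<close>.\<close>
  have step: "real (count_list xs i) *\<^sub>R perm_sum (take N ((map v xs)[k := map v xs ! N])) =
      (fact N * F) *\<^sub>R g i" if k: "k < Suc N" "i = xs ! k" for i k
  proof -
    define ys where "ys = take N (xs[k := xs ! N])"
    have eq: "take N ((map v xs)[k := map v xs ! N]) = map v ys"
      using Suc k by (simp add: ys_def take_map[symmetric] map_update)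
    have ms: "mset xs = add_mset i (mset ys)"
      using mset_take_update[of xs N k] Suc k by (simp add: ys_def)
    have len: "N = length ys" using Suc by (simp add: ys_def)
    have "set ys \<subseteq> {0, 1, 2}" "i \<in> {0, 1, 2}"
      using arg_cong[OF ms, of set_mset] Suc.prems by auto
    note IH = Suc.hyps(1)[OF len this(1)]
    have cnt: "count_list xs j = (if i = j then 1 else 0) + count_list ys j" for j
      using ms by (simp add: count_list_eq_count)
    define a' b' c' where "a' = count_list ys 0" and "b' = count_list ys 1" and "c' = count_list ys 2"
    have IH': "perm_sum (map v ys) = (fact N * (fact a' * fact b' * fact c')) *\<^sub>R etaD 0 0 0 (a', b', c') w"
      using IH by (simp only: len[symmetric] a'_def b'_def c'_def)
    from \<open>i \<in> {0, 1, 2}\<close> consider "i = 0" | "i = 1" | "i = 2" by auto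
    thus ?thesis
    proof cases
      case 1
      hence "a = Suc a'" "b = b'" "c = c'" "count_list xs i = Suc a'"
        using cnt[of 0] cnt[of 1] cnt[of 2] by (simp_all add: a_def b_def c_def a'_def b'_def c'_def)
      thus ?thesis unfolding eq IH' using 1 by (simp add: F_def g_def etaD_shift mult_ac del: of_nat_Suc)
    next
      case 2
      hence "a = a'" "b = Suc b'" "c = c'" "count_list xs i = Suc b'"
        using cnt[of 0] cnt[of 1] cnt[of 2] by (simp_all add: a_def b_def c_def a'_def b'_def c'_def)
      thus ?thesis unfolding eq IH' using 2 by (simp add: F_def g_def etaD_shift mult_ac del: of_nat_Suc)
    next
      case 3
      hence "a = a'" "b = b'" "c = Suc c'" "count_list xs i = Suc c'"
        using cnt[of 0] cnt[of 1] cnt[of 2] by (simp_all add: a_def b_def c_def a'_def b'_def c'_def)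
      thus ?thesis unfolding eq IH' using 3 by (simp add: F_def g_def etaD_shift mult_ac del: of_nat_Suc)
    qed
  qed
  have "perm_sum (map v xs) = (\<Sum>k<Suc N. perm_sum (take N ((map v xs)[k := map v xs ! N])) * map v xs ! k)"
    by (rule perm_sum_Suc) (use Suc in simp)
  also have "\<dots> = (\<Sum>k<Suc N. (\<lambda>i. ((fact N * F) / count_list xs i) *\<^sub>R (g i * v i)) (xs ! k))"
  proof (intro sum.cong refl)
    fix k assume "k \<in> {..<Suc N}"
    hence k: "k < Suc N" by simp
    have "count_list xs (xs ! k) \<noteq> 0" using k Suc by (simp add: count_list_0_iff)
    hence "perm_sum (take N ((map v xs)[k := map v xs ! N])) = ((fact N * F) / count_list xs (xs ! k)) *\<^sub>R g (xs ! k)"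
      using arg_cong[OF step[OF k refl], of "\<lambda>x. (1 / real (count_list xs (xs ! k))) *\<^sub>R x"] by simp
    moreover have "map v xs ! k = v (xs ! k)" using k Suc by simp
    ultimately show "perm_sum (take N ((map v xs)[k := map v xs ! N])) * map v xs ! k =
      (\<lambda>i. ((fact N * F) / count_list xs i) *\<^sub>R (g i * v i)) (xs ! k)"
      by simp
  qed
  also have "\<dots> = (\<Sum>x\<leftarrow>xs. ((fact N * F) / count_list xs x) *\<^sub>R (g x * v x))"
    using Suc by (simp add: sum_list_sum_nth atLeast0LessThan)
  also have "\<dots> = (\<Sum>x\<in>{0,1,2}. real (count_list xs x) *\<^sub>R (((fact N * F) / count_list xs x) *\<^sub>R (g x * v x)))"
    by (rule sum_list_map_eq_sum_count_scaleR) (use Suc.prems in auto)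
  also have "\<dots> = (\<Sum>x\<in>{0,1,2}. (fact N * F) *\<^sub>R (g x * v x))"
  proof (intro sum.cong refl)
    fix x :: nat assume "x \<in> {0,1,2}"
    \<comment> \<open>The multiplicity cancels only if it is nonzero. For an absent label the left
      side is 0, and so is the right side, since the exponent 0 cannot be lowered.\<close>
    hence "g x = 0" if "count_list xs x = 0"
      using that by (auto simp: g_def a_def b_def c_def hyp_eq_parts cpart_etaD npart_etaD)
        (auto simp: cpart_def npart_def complex_eq_iff dpow_def)
    thus "real (count_list xs x) *\<^sub>R (((fact N * F) / count_list xs x) *\<^sub>R (g x * v x)) = (fact N * F) *\<^sub>R (g x * v x)"
      by (cases "count_list xs x = 0") auto
  qed
  also have "\<dots> = (fact N * F) *\<^sub>R (g 0 * v 0 + g 1 * v 1 + g 2 * v 2)"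
    by (simp add: scaleR_add_right)
  also have "g 0 * v 0 + g 1 * v 1 + g 2 * v 2 = real (Suc N) *\<^sub>R etaD 0 0 0 (a, b, c) w"
    using etaD_rec[of a b c w] N by (simp add: g_def v_def)
  finally show ?case
    unfolding Suc.hyps(2)[symmetric] a_def[symmetric] b_def[symmetric] c_def[symmetric]
    by (simp add: F_def mult_ac)
qed

lemma eta_pow_eq_etaD: "eta_pow n w = etaD 0 0 0 n w"
proof (cases n)
  case (fields a b c)
  define xs :: "nat list" where "xs = replicate a 0 @ replicate b 1 @ replicate c 2"
  define fs where "fs = replicate a eta2 @ replicate b eta3 @ replicate c eta4"
  define v where "v i = (if i = 0 then eta2 w else if i = 1 then eta3 w else eta4 w)" for i :: nat
  have fs: "map (\<lambda>f. f w) fs = map v xs" "length fs = length xs"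
    by (simp_all add: fs_def xs_def v_def)
  have "perm_sum (map (\<lambda>f. f w) fs) =
    (\<Sum>\<sigma> | \<sigma> permutes {..<length fs}. prod_list (map (\<lambda>m. (fs ! \<sigma> m) w) [0..<length fs]))"
    unfolding perm_sum_def length_map
  proof (intro sum.cong refl arg_cong[of _ _ prod_list] map_cong)
    fix \<sigma> m assume "\<sigma> \<in> {\<sigma>. \<sigma> permutes {..<length fs}}" "m \<in> set [0..<length fs]"
    hence "\<sigma> m < length fs" using permutes_in_image[of \<sigma> "{..<length fs}" m] by simp
    thus "map (\<lambda>f. f w) fs ! \<sigma> m = (fs ! \<sigma> m) w" by simp
  qed
  hence "symprod fs w = (1 / fact (length xs)) *\<^sub>R perm_sum (map v xs)"
    by (simp add: symprod_def fs)
  moreover have "perm_sum (map v xs) = (fact (length xs) * (fact a * fact b * fact c)) *\<^sub>R etaD 0 0 0 (a, b, c) w"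
  proof -
    have "count_list xs 0 = a" "count_list xs 1 = b" "count_list xs 2 = c" "set xs \<subseteq> {0,1,2}"
      by (auto simp: xs_def count_list_eq_count)
    thus ?thesis using perm_sum_eq_etaD[of xs w] by (simp add: v_def[abs_def])
  qed
  ultimately have "symprod fs w = (fact a * fact b * fact c) *\<^sub>R etaD 0 0 0 (a, b, c) w" by simp
  thus ?thesis by (simp add: fields fs_def)
qed

subsection \<open>Regularity of convergent expansions\<close>

lemma abs_hyp_sel_le:
  "\<bar>hx1 w\<bar> \<le> norm w" "\<bar>hx2 w\<bar> \<le> norm w" "\<bar>hx3 w\<bar> \<le> norm w" "\<bar>hx4 w\<bar> \<le> norm w"
  using abs_Re_le_cmod[of "cpart w"] abs_Im_le_cmod[of "cpart w"] norm_cpart_le[of w]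
    abs_Re_le_cmod[of "npart w"] abs_Im_le_cmod[of "npart w"] norm_npart_le[of w]
  by (simp_all add: cpart_def npart_def)

lemma bounded_linear_hyp_sel:
  "bounded_linear hx1" "bounded_linear hx2" "bounded_linear hx3" "bounded_linear hx4"
  by (rule bounded_linear_intro[of _ 1]; simp add: abs_hyp_sel_le)+

lemma bounded_linear_zeta: "bounded_linear zeta"
proof (rule bounded_linear_intro[of _ 1])
  show "norm (zeta w) \<le> norm w * 1" for w
    by (simp add: zeta_def norm_hyp_def inner_hyp_def cmod_def power2_eq_square)
qed (simp_all add: zeta_def complex_eq_iff)

lemma bounded_linear_cpart: "bounded_linear cpart" and bounded_linear_npart: "bounded_linear npart"
  by (rule bounded_linear_intro[of _ 1]; simp add: norm_cpart_le norm_npart_le)+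

lemma bounded_bilinear_hyp_mult: "bounded_bilinear ((*) :: hyp \<Rightarrow> hyp \<Rightarrow> hyp)"
  by (standard; (simp add: algebra_simps)?)
    (rule exI[of _ 3], use norm_hyp_mult_le in \<open>simp add: mult_ac\<close>)

lemma has_sum_hyp_mult_left:
  fixes v l :: hyp
  assumes "(f has_sum l) A"
  shows "((\<lambda>n. v * f n) has_sum v * l) A"
  using has_sum_bounded_linear[OF bounded_bilinear.bounded_linear_right[OF bounded_bilinear_hyp_mult] assms]
  by (simp add: o_def)

lemma has_derivative_dpow_zeta:
  "((\<lambda>w. dpow p k (zeta w)) has_derivative (\<lambda>h. dpow (Suc p) k (zeta w) * zeta h)) (at w)"
  using has_derivative_compose[OF bounded_linear_imp_has_derivative[OF bounded_linear_zeta]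
      has_field_derivative_imp_has_derivative[OF has_field_derivative_dpow]] by simp

lemma has_derivative_dpow_hx3:
  "((\<lambda>w. dpow p k (hx3 w)) has_derivative (\<lambda>h. dpow (Suc p) k (hx3 w) * hx3 h)) (at w)"
  using has_derivative_compose[OF bounded_linear_imp_has_derivative[OF bounded_linear_hyp_sel(3)]
      has_field_derivative_imp_has_derivative[OF has_field_derivative_dpow]] by simp

lemma has_derivative_dpow_hx4:
  "((\<lambda>w. dpow p k (hx4 w)) has_derivative (\<lambda>h. dpow (Suc p) k (hx4 w) * hx4 h)) (at w)"
  using has_derivative_compose[OF bounded_linear_imp_has_derivative[OF bounded_linear_hyp_sel(4)]
      has_field_derivative_imp_has_derivative[OF has_field_derivative_dpow]] by simp

text \<open>The coefficient of \<open>hx1 h\<close> reflects that \<open>x\<^sub>1\<close>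
  differentiates the generating function to \<open>- J\<close> times itself. It is minus what
  \<open>nabla0\<close> collects from the other three directions, so each term is regular by
  construction.\<close>

definition etaD' :: "nat \<times> nat \<times> nat \<Rightarrow> hyp \<Rightarrow> hyp \<Rightarrow> hyp" where
  "etaD' n w h = hx2 h *\<^sub>R etaD 1 0 0 n w + hx3 h *\<^sub>R etaD 0 1 0 n w + hx4 h *\<^sub>R etaD 0 0 1 n w
     - hx1 h *\<^sub>R (hi * etaD 1 0 0 n w + hj * etaD 0 1 0 n w + hk * etaD 0 0 1 n w)"

lemma has_derivative_eta: "(etaD 0 0 0 n has_derivative etaD' n w) (at w)"
proof -
  obtain a b c where n: "n = (a, b, c)" by (cases n)
  note der = has_derivative_dpow_zeta has_derivative_dpow_hx3 has_derivative_dpow_hx4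
  have "((\<lambda>w. etaD 0 0 0 n w \<bullet> i) has_derivative (\<lambda>h. etaD' n w h \<bullet> i)) (at w)"
    if "i \<in> Basis" for i
  proof -
    from that consider "i = 1" | "i = hi" | "i = hj" | "i = hk" by (auto simp: Basis_hyp_def)
    thus ?thesis
    proof cases
      case 1
      show ?thesis unfolding n 1
        by (simp add: inner_hyp_def etaD_def etaD'_def Let_def hi_def hj_def hk_def)
          (rule derivative_eq_intros der refl | simp add: fun_eq_iff algebra_simps zeta_def hyp_ops_defs)+
    next
      case 2
      show ?thesis unfolding n 2
        by (simp add: inner_hyp_def etaD_def etaD'_def Let_def hi_def hj_def hk_def)
          (rule derivative_eq_intros der refl | simp add: fun_eq_iff algebra_simps zeta_def hyp_ops_defs)+
    next
      case 3
      show ?thesis unfolding n 3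
        by (simp add: inner_hyp_def etaD_def etaD'_def Let_def hi_def hj_def hk_def)
          (rule derivative_eq_intros der refl | simp add: fun_eq_iff algebra_simps zeta_def hyp_ops_defs)+
    next
      case 4
      show ?thesis unfolding n 4
        by (simp add: inner_hyp_def etaD_def etaD'_def Let_def hi_def hj_def hk_def)
          (rule derivative_eq_intros der refl | simp add: fun_eq_iff algebra_simps zeta_def hyp_ops_defs)+
    qed
  qed
  thus ?thesis unfolding has_derivative_componentwise_within[of "etaD 0 0 0 n"] by blast
qed

text \<open>The exact absolute value of the complex part of the divided power at a point where
  \<open>zeta\<close>, \<open>hx3\<close> and \<open>hx4\<close> have absolute values
  \<open>R2\<close>, \<open>R3\<close>, \<open>R4\<close>.\<close>

definition box_weight :: "real \<Rightarrow> real \<Rightarrow> real \<Rightarrow> nat \<times> nat \<times> nat \<Rightarrow> real" where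
  "box_weight R2 R3 R4 n = (case n of (a, b, c) \<Rightarrow> dpow 0 a R2 * dpow 0 b R3 * dpow 0 c R4)"

lemma box_weight_nonneg: "0 \<le> R2 \<Longrightarrow> 0 \<le> R3 \<Longrightarrow> 0 \<le> R4 \<Longrightarrow> 0 \<le> box_weight R2 R3 R4 n"
  by (auto simp: box_weight_def dpow_nonneg split: prod.splits)

lemma box_weight_mono:
  "0 \<le> r2 \<Longrightarrow> 0 \<le> r3 \<Longrightarrow> 0 \<le> r4 \<Longrightarrow> r2 \<le> R2 \<Longrightarrow> r3 \<le> R3 \<Longrightarrow> r4 \<le> R4 \<Longrightarrow>
    box_weight r2 r3 r4 n \<le> box_weight R2 R3 R4 n"
  by (auto simp: box_weight_def intro!: mult_mono mult_nonneg_nonneg dpow_mono dpow_nonneg split: prod.splits)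

text \<open>Serves the nilpotent part of \<open>etaD\<close>, whose \<open>zeta\<close>-exponent is
  one too high. Without derivatives the surplus factor is at most \<open>r\<close>; otherwise one
  derivative cancels the shift.\<close>

lemma dpow_Suc_le_dpow:
  fixes r R :: real
  assumes "0 \<le> r" "r < R"
  shows "\<exists>C\<ge>0. \<forall>k. dpow j (Suc k) r \<le> C * dpow 0 k R"
proof (cases j)
  case 0
  have "dpow 0 (Suc k) r \<le> r * dpow 0 k R" for k
  proof -
    have "r * dpow 0 k r = real (Suc k) * dpow 0 (Suc k) r"
      using dpow_Suc_times[of r 0 "Suc k"] by simp
    moreover have "1 * dpow 0 (Suc k) r \<le> real (Suc k) * dpow 0 (Suc k) r"
      using assms by (intro mult_right_mono dpow_nonneg) auto
    moreover have "r * dpow 0 k r \<le> r * dpow 0 k R"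
      using assms by (intro mult_left_mono dpow_mono) auto
    ultimately show ?thesis by linarith
  qed
  thus ?thesis using 0 assms by auto
next
  case (Suc p)
  thus ?thesis using dpow_le_dpow[OF assms] by simp
qed

text \<open>The strict gap between the radii absorbs the lowered exponents and the shift, so one
  weight majorizes the divided powers and all their derivatives.\<close>

lemma norm_etaD_le:
  assumes "0 \<le> r2" "r2 < R2" "0 \<le> r3" "r3 < R3" "0 \<le> r4" "r4 < R4"
  shows "\<exists>C\<ge>0. \<forall>n w. norm (zeta w) \<le> r2 \<and> \<bar>hx3 w\<bar> \<le> r3 \<and> \<bar>hx4 w\<bar> \<le> r4 \<longrightarrow>
    norm (etaD p q s n w) \<le> C * box_weight R2 R3 R4 n"
proof -
  obtain A where A: "A \<ge> 0" "\<And>k. dpow p k r2 \<le> A * dpow 0 k R2"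
    using dpow_le_dpow[of r2 R2 p] assms by auto
  obtain B where B: "B \<ge> 0" "\<And>k. dpow p (Suc k) r2 \<le> B * dpow 0 k R2"
    using dpow_Suc_le_dpow[of r2 R2 p] assms by auto
  obtain X where X: "X \<ge> 0" "\<And>k. dpow q k r3 \<le> X * dpow 0 k R3"
    using dpow_le_dpow[of r3 R3 q] assms by auto
  obtain X' where X': "X' \<ge> 0" "\<And>k. dpow (Suc q) k r3 \<le> X' * dpow 0 k R3"
    using dpow_le_dpow[of r3 R3 "Suc q"] assms by auto
  obtain Y where Y: "Y \<ge> 0" "\<And>k. dpow s k r4 \<le> Y * dpow 0 k R4"
    using dpow_le_dpow[of r4 R4 s] assms by auto
  obtain Y' where Y': "Y' \<ge> 0" "\<And>k. dpow (Suc s) k r4 \<le> Y' * dpow 0 k R4"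
    using dpow_le_dpow[of r4 R4 "Suc s"] assms by auto
  have up: "norm (dpow j k x) \<le> K * dpow 0 l R"
    if "dpow j k r \<le> K * dpow 0 l R" "norm x \<le> r" for j k l :: nat and x :: "'a::real_normed_field" and r K R
    unfolding norm_dpow using dpow_mono[OF norm_ge_zero that(2), of j k] that(1) by linarith
  have "norm (etaD p q s n w) \<le> (A * X * Y + B * (X' * Y) + B * (X * Y')) * box_weight R2 R3 R4 n"
    if w: "norm (zeta w) \<le> r2" "\<bar>hx3 w\<bar> \<le> r3" "\<bar>hx4 w\<bar> \<le> r4" for n w
  proof -
    obtain a b c where n: "n = (a, b, c)" by (cases n)
    define DA DB DC where "DA = dpow 0 a R2" and "DB = dpow 0 b R3" and "DC = dpow 0 c R4"
    have D: "0 \<le> DA" "0 \<le> DB" "0 \<le> DC"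
      unfolding DA_def DB_def DC_def using assms by (auto intro: dpow_nonneg)
    have u: "norm (dpow p a (zeta w)) \<le> A * DA" unfolding DA_def by (rule up[OF A(2)]) (rule w)
    have v: "\<bar>Im (dpow p (Suc a) (zeta w))\<bar> \<le> B * DA" unfolding DA_def
      by (rule order_trans[OF abs_Im_le_cmod up[OF B(2)]]) (rule w)
    have x: "\<bar>dpow q b (hx3 w)\<bar> \<le> X * DB" "\<bar>dpow (Suc q) b (hx3 w)\<bar> \<le> X' * DB"
      unfolding DB_def using up[OF X(2), of "hx3 w"] up[OF X'(2), of "hx3 w"] w by auto
    have y: "\<bar>dpow s c (hx4 w)\<bar> \<le> Y * DC" "\<bar>dpow (Suc s) c (hx4 w)\<bar> \<le> Y' * DC"
      unfolding DC_def using up[OF Y(2), of "hx4 w"] up[OF Y'(2), of "hx4 w"] w by auto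
    have "norm (cpart (etaD p q s n w)) \<le> (A * DA) * ((X * DB) * (Y * DC))"
      unfolding n cpart_etaD using D A X
      by (auto simp: norm_mult abs_mult intro!: mult_mono u x y)
    moreover have "norm (npart (etaD p q s n w)) \<le> (B * DA) * ((X' * DB) * (Y * DC) + (X * DB) * (Y' * DC))"
    proof -
      have "norm (Complex l m) \<le> \<bar>l\<bar> + \<bar>m\<bar>" for l m using cmod_le[of "Complex l m"] by simp
      hence "norm (npart (etaD p q s n w)) \<le> \<bar>Im (dpow p (Suc a) (zeta w))\<bar> *
          (\<bar>dpow (Suc q) b (hx3 w) * dpow s c (hx4 w)\<bar> + \<bar>dpow q b (hx3 w) * dpow (Suc s) c (hx4 w)\<bar>)"
        unfolding n npart_etaD by (simp add: norm_mult mult_left_mono del: dpow_Suc_Suc)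
      also have "\<dots> \<le> (B * DA) * ((X' * DB) * (Y * DC) + (X * DB) * (Y' * DC))"
        unfolding abs_mult using D B X X' by (intro mult_mono add_mono v x y) auto
      finally show ?thesis .
    qed
    ultimately have "norm (etaD p q s n w) \<le>
        (A * DA) * ((X * DB) * (Y * DC)) + (B * DA) * ((X' * DB) * (Y * DC) + (X * DB) * (Y' * DC))"
      using norm_hyp_le_parts[of "etaD p q s n w"] by linarith
    thus ?thesis by (simp add: n box_weight_def DA_def DB_def DC_def algebra_simps)
  qed
  moreover have "A * X * Y + B * (X' * Y) + B * (X * Y') \<ge> 0"
    using A B X X' Y Y' by auto
  ultimately show ?thesis by blast
qed

lemma partial_eq:
  assumes "(f has_derivative D) (at w)"
  shows "partial e f w = D e"
proof -
  have "((\<lambda>t. w + t *\<^sub>R e) has_derivative (\<lambda>t. t *\<^sub>R e)) (at 0)"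
    by (auto intro!: derivative_eq_intros)
  moreover have "(f has_derivative D) (at (w + 0 *\<^sub>R e))" using assms by simp
  ultimately have "((\<lambda>t. f (w + t *\<^sub>R e)) has_derivative (\<lambda>t. D (t *\<^sub>R e))) (at 0)"
    by (rule has_derivative_compose)
  moreover have "D (t *\<^sub>R e) = t *\<^sub>R D e" for t
    by (rule linear_scale[OF has_derivative_linear[OF assms]])
  ultimately have "((\<lambda>t. f (w + t *\<^sub>R e)) has_vector_derivative D e) (at 0)"
    by (simp add: has_vector_derivative_def)
  thus ?thesis unfolding partial_def by (rule vector_derivative_at)
qed

lemma eta_series_regular:
  fixes \<phi> :: "nat \<times> nat \<times> nat \<Rightarrow> hyp"
  assumes sm: "(\<lambda>n. box_weight R2 R3 R4 n * norm (\<phi> n)) summable_on UNIV"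
    and w: "norm (zeta w) < R2" "\<bar>hx3 w\<bar> < R3" "\<bar>hx4 w\<bar> < R4"
  defines "g \<equiv> (\<lambda>w. \<Sum>\<^sub>\<infinity>n. etaD 0 0 0 n w * \<phi> n)"
  shows "(\<lambda>n. etaD 0 0 0 n w * \<phi> n) summable_on UNIV"
    and "g differentiable (at w)" and "nabla0 g w = 0"
proof -
  \<comment> \<open>Midpoint radii give an open box around \<open>w\<close> that keeps the strict
    distance to \<open>R2\<close>, \<open>R3\<close>, \<open>R4\<close> required by
    \<open>norm_etaD_le\<close>.\<close>
  define r2 r3 r4 where "r2 = (norm (zeta w) + R2) / 2" and "r3 = (\<bar>hx3 w\<bar> + R3) / 2"
    and "r4 = (\<bar>hx4 w\<bar> + R4) / 2"
  have wr: "norm (zeta w) < r2" "\<bar>hx3 w\<bar> < r3" "\<bar>hx4 w\<bar> < r4"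
    using w by (auto simp: r2_def r3_def r4_def)
  have r: "0 \<le> r2" "r2 < R2" "0 \<le> r3" "r3 < R3" "0 \<le> r4" "r4 < R4"
    using w wr norm_ge_zero[of "zeta w"] by (auto simp: r2_def r3_def r4_def simp del: norm_ge_zero)
  define S where "S = {w. norm (zeta w) < r2 \<and> \<bar>hx3 w\<bar> < r3 \<and> \<bar>hx4 w\<bar> < r4}"
  have S_eq: "S = zeta -` ball 0 r2 \<inter> hx3 -` ball 0 r3 \<inter> hx4 -` ball 0 r4"
    by (auto simp: S_def)
  have "open S" unfolding S_eq
    by (intro open_Int open_vimage open_ball linear_continuous_on bounded_linear_zeta bounded_linear_hyp_sel)
  have "convex S" unfolding S_eq
    by (intro convex_Int convex_linear_vimage convex_ball bounded_linear.linear bounded_linear_zeta bounded_linear_hyp_sel)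
  have "w \<in> S" using wr by (simp add: S_def)
  define W where "W = box_weight R2 R3 R4"
  have ex: "\<exists>C. C \<ge> 0 \<and> (\<forall>n y. y \<in> S \<longrightarrow> norm (etaD p q s n y) \<le> C * W n)" for p q s
  proof -
    obtain C where C: "C \<ge> 0" "\<forall>n w. norm (zeta w) \<le> r2 \<and> \<bar>hx3 w\<bar> \<le> r3 \<and> \<bar>hx4 w\<bar> \<le> r4 \<longrightarrow>
        norm (etaD p q s n w) \<le> C * W n"
      using norm_etaD_le[OF r, of p q s] unfolding W_def by blast
    have "norm (etaD p q s n y) \<le> C * W n" if "y \<in> S" for n y
      using that by (intro C(2)[rule_format]) (simp add: S_def)
    thus ?thesis using C(1) by blast
  qed
  define C where "C p q s = (SOME C. C \<ge> 0 \<and> (\<forall>n y. y \<in> S \<longrightarrow> norm (etaD p q s n y) \<le> C * W n))" for p q s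
  have Cspec: "C p q s \<ge> 0 \<and> (\<forall>n y. y \<in> S \<longrightarrow> norm (etaD p q s n y) \<le> C p q s * W n)" for p q s
    unfolding C_def by (rule someI_ex) (rule ex)
  have C: "C p q s \<ge> 0" for p q s using Cspec by blast
  have C': "norm (etaD p q s n y) \<le> C p q s * W n" if "y \<in> S" for p q s n y
    using Cspec that by blast
  have W0: "W n \<ge> 0" for n unfolding W_def using r by (intro box_weight_nonneg) auto
  have summ: "(\<lambda>n. etaD p q s n y * \<phi> n) summable_on UNIV" if "y \<in> S" for p q s y
  proof (rule abs_summable_summable[OF Infinite_Sum.abs_summable_on_comparison_test'])
    show "(\<lambda>n. 3 * C p q s * (W n * norm (\<phi> n))) summable_on UNIV"
      using sm unfolding W_def by (rule summable_on_cmult_right)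
    show "norm (etaD p q s n y * \<phi> n) \<le> 3 * C p q s * (W n * norm (\<phi> n))" for n
      using norm_hyp_mult_le[of "etaD p q s n y" "\<phi> n"]
        mult_right_mono[OF C'[OF that, of p q s n] norm_ge_zero[of "\<phi> n"]] by simp
  qed
  show "(\<lambda>n. etaD 0 0 0 n w * \<phi> n) summable_on UNIV" by (rule summ) fact
  define K where "K = C 1 0 0 + C 0 1 0 + C 0 0 1"
  \<comment> \<open>Directions 2, 3, 4 contribute 1 and direction 1 contributes 3, from multiplying
    by units. The later product with the coefficient brings another 3, hence 12.\<close>
  have D': "norm (etaD' n y h) \<le> 4 * K * W n * norm h" if "y \<in> S" for n y h
  proof -
    have unit: "norm hi \<le> 1" "norm hj \<le> 1" "norm hk \<le> 1"
      by (simp_all add: norm_hyp_def inner_hyp_def hi_def hj_def hk_def)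
    have m: "norm (v * z) \<le> 3 * norm z" if "norm v \<le> 1" for v z :: hyp
      using norm_hyp_mult_le[of v z] mult_right_mono[OF that norm_ge_zero[of z]] by simp
    define E1 E2 E3 where "E1 = etaD 1 0 0 n y" and "E2 = etaD 0 1 0 n y" and "E3 = etaD 0 0 1 n y"
    have s: "norm (r *\<^sub>R z) \<le> norm h * norm z" if "\<bar>r\<bar> \<le> norm h" for r and z :: hyp
      using that by (simp add: mult_right_mono)
    have tri: "norm (x1 + x2 + x3) \<le> norm x1 + norm x2 + norm x3" for x1 x2 x3 :: hyp
      by (intro norm_triangle_le add_right_mono order_refl)
    define T where "T = norm E1 + norm E2 + norm E3"
    have I: "norm (hi * E1 + hj * E2 + hk * E3) \<le> 3 * T"
    proof -
      have "norm (hi * E1 + hj * E2 + hk * E3) \<le> 3 * norm E1 + 3 * norm E2 + 3 * norm E3"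
        by (rule order_trans[OF tri]) (intro add_mono m unit)
      thus ?thesis by (simp add: T_def)
    qed
    have "norm (etaD' n y h) \<le> norm (hx2 h *\<^sub>R E1 + hx3 h *\<^sub>R E2 + hx4 h *\<^sub>R E3)
        + norm (hx1 h *\<^sub>R (hi * E1 + hj * E2 + hk * E3))"
      unfolding etaD'_def E1_def E2_def E3_def by (rule norm_triangle_ineq4)
    moreover have "norm (hx2 h *\<^sub>R E1 + hx3 h *\<^sub>R E2 + hx4 h *\<^sub>R E3) \<le> norm h * T"
      unfolding T_def distrib_left by (rule order_trans[OF tri]) (intro add_mono s abs_hyp_sel_le)
    moreover have "norm (hx1 h *\<^sub>R (hi * E1 + hj * E2 + hk * E3)) \<le> norm h * (3 * T)"
      by (rule order_trans[OF s[OF abs_hyp_sel_le(1)] mult_left_mono[OF I norm_ge_zero]])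
    ultimately have "norm (etaD' n y h) \<le> norm h * (4 * T)" by simp
    moreover have "T \<le> K * W n"
      unfolding T_def E1_def E2_def E3_def K_def distrib_right by (intro add_mono C' that)
    hence "norm h * (4 * T) \<le> norm h * (4 * (K * W n))" by (intro mult_left_mono) auto
    ultimately show ?thesis by (simp add: mult_ac)
  qed
  have B: "norm (etaD' n y h * \<phi> n) \<le> (12 * K * (W n * norm (\<phi> n))) * norm h" if "y \<in> S" for n y h
  proof -
    have "norm (etaD' n y h * \<phi> n) \<le> 3 * (norm (etaD' n y h) * norm (\<phi> n))"
      by (rule norm_hyp_mult_le)
    also have "\<dots> \<le> 3 * ((4 * K * W n * norm h) * norm (\<phi> n))"
      by (intro mult_left_mono mult_right_mono D' that) auto
    finally show ?thesis by (simp add: mult_ac)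
  qed
  have gd: "(g has_derivative (\<lambda>h. \<Sum>\<^sub>\<infinity>n. etaD' n w h * \<phi> n)) (at w)"
  proof (rule has_derivative_infsum(1)[OF \<open>open S\<close> \<open>convex S\<close> \<open>w \<in> S\<close>])
    show "((\<lambda>y. etaD 0 0 0 n y * \<phi> n) has_derivative (\<lambda>h. etaD' n y h * \<phi> n)) (at y)" for n y
      using bounded_linear.has_derivative[OF bounded_bilinear.bounded_linear_left[OF bounded_bilinear_hyp_mult] has_derivative_eta] .
    show "(\<lambda>n. 12 * K * (W n * norm (\<phi> n))) summable_on UNIV"
      using sm unfolding W_def by (rule summable_on_cmult_right)
    show "((\<lambda>n. etaD 0 0 0 n y * \<phi> n) has_sum g y) UNIV" if "y \<in> S" for y
      unfolding g_def by (rule has_sum_infsum[OF summ[OF that]])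
  qed (rule B)
  thus "g differentiable (at w)" by (auto simp: differentiable_def)
  define s1 s2 s3 where "s1 = (\<Sum>\<^sub>\<infinity>n. etaD 1 0 0 n w * \<phi> n)" and
    "s2 = (\<Sum>\<^sub>\<infinity>n. etaD 0 1 0 n w * \<phi> n)" and "s3 = (\<Sum>\<^sub>\<infinity>n. etaD 0 0 1 n w * \<phi> n)"
  have hs: "((\<lambda>n. etaD 1 0 0 n w * \<phi> n) has_sum s1) UNIV" "((\<lambda>n. etaD 0 1 0 n w * \<phi> n) has_sum s2) UNIV"
    "((\<lambda>n. etaD 0 0 1 n w * \<phi> n) has_sum s3) UNIV"
    unfolding s1_def s2_def s3_def using has_sum_infsum[OF summ[OF \<open>w \<in> S\<close>]] by blast+
  have "((\<lambda>n. - (hi * (etaD 1 0 0 n w * \<phi> n) + hj * (etaD 0 1 0 n w * \<phi> n) + hk * (etaD 0 0 1 n w * \<phi> n)))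
      has_sum - (hi * s1 + hj * s2 + hk * s3)) UNIV"
    unfolding has_sum_uminus minus_minus by (intro has_sum_add has_sum_hyp_mult_left hs)
  \<comment> \<open>Coefficients stand on the right and the units of \<open>nabla0\<close> on the
    left, so associativity lets the termwise cancellation pass through the sum.\<close>
  moreover have "etaD' n w 1 * \<phi> n = - (hi * (etaD 1 0 0 n w * \<phi> n) + hj * (etaD 0 1 0 n w * \<phi> n) + hk * (etaD 0 0 1 n w * \<phi> n))" for n
    by (simp add: etaD'_def algebra_simps)
  ultimately have p1: "(\<Sum>\<^sub>\<infinity>n. etaD' n w 1 * \<phi> n) = - (hi * s1 + hj * s2 + hk * s3)"
    using infsumI by simp
  have "etaD' n w hi = etaD 1 0 0 n w" "etaD' n w hj = etaD 0 1 0 n w" "etaD' n w hk = etaD 0 0 1 n w" for n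
    by (simp_all add: etaD'_def hi_def hj_def hk_def)
  thus "nabla0 g w = 0"
    unfolding nabla0_def partial_eq[OF gd] p1 by (simp add: s1_def s2_def s3_def)
qed

text \<open>Moving slightly outward from \<open>w\<close> within \<open>V\<close> bounds first the complex parts of the
  coefficients, which control the mixed term in the nilpotent part of each summand, and then,
  at a point halfway back, their nilpotent parts.\<close>

lemma eta_series_majorant:
  fixes \<phi> :: "nat \<times> nat \<times> nat \<Rightarrow> hyp"
  assumes V: "open V" "w \<in> V"
    and sm: "\<And>w. w \<in> V \<Longrightarrow> (\<lambda>n. etaD 0 0 0 n w * \<phi> n) summable_on UNIV"
  shows "\<exists>R2 R3 R4. norm (zeta w) < R2 \<and> \<bar>hx3 w\<bar> < R3 \<and> \<bar>hx4 w\<bar> < R4 \<and>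
    (\<lambda>n. box_weight R2 R3 R4 n * norm (\<phi> n)) summable_on UNIV"
proof -
  \<comment> \<open>Along \<open>d\<close> the three quantities \<bar>zeta\<bar>, \<bar>hx3\<bar>
    and \<bar>hx4\<bar> all grow at rate exactly 1: \<open>u\<close> is the radial unit vector at
    \<open>zeta w\<close>, arbitrary if that is 0, and the signs match those of \<open>hx3 w\<close>
    and \<open>hx4 w\<close>.\<close>
  define u where "u = (if zeta w = 0 then 1 else sgn (zeta w))"
  define d where "d = Hyp (Im u) (Re u) (if hx3 w < 0 then -1 else 1) (if hx4 w < 0 then -1 else 1)"
  obtain e where e: "e > 0" "ball w e \<subseteq> V" using V open_contains_ball by blast
  define \<delta> where "\<delta> = e / (norm d + 1)"
  have \<delta>: "\<delta> > 0" using e by (simp add: \<delta>_def add_nonneg_pos)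
  define P where "P t = w + t *\<^sub>R d" for t
  have P: "P t \<in> V" if "0 \<le> t" "t \<le> \<delta>" for t
  proof -
    have "t * norm d \<le> \<delta> * norm d" using that by (intro mult_right_mono) auto
    also have "\<dots> < \<delta> * (norm d + 1)" using \<delta> by simp
    also have "\<dots> = e" unfolding \<delta>_def by (simp add: add_nonneg_eq_0_iff)
    finally have "t * norm d < e" .
    thus ?thesis using e that by (auto simp: P_def dist_norm subset_iff)
  qed
  have z: "norm (zeta (P t)) = norm (zeta w) + t" if "0 \<le> t" for t
  proof -
    have "zeta (P t) = zeta w + t *\<^sub>R u"
      by (simp add: zeta_def P_def d_def complex_eq_iff)
    also have "\<dots> = (norm (zeta w) + t) *\<^sub>R u"
      by (simp add: u_def sgn_div_norm scaleR_add_left)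
    finally show ?thesis using that by (simp add: u_def norm_sgn)
  qed
  have x: "\<bar>hx3 (P t)\<bar> = \<bar>hx3 w\<bar> + t" "\<bar>hx4 (P t)\<bar> = \<bar>hx4 w\<bar> + t" if "0 \<le> t" for t
    using that by (auto simp: P_def d_def)
  define W where "W t = box_weight (norm (zeta w) + t) (\<bar>hx3 w\<bar> + t) (\<bar>hx4 w\<bar> + t)" for t
  have nc: "norm (cpart (etaD 0 0 0 n (P t))) = W t n" if "0 \<le> t" for n t
    using that z[OF that] x[OF that]
    by (cases n) (simp add: cpart_etaD W_def box_weight_def norm_mult norm_dpow abs_mult
        norm_dpow[where 'a=real, simplified])
  \<comment> \<open>Unordered summability of complex numbers is already absolute, which turns
    convergence at a point into bounds.\<close>
  have sc: "(\<lambda>n. norm (cpart (etaD 0 0 0 n (P t) * \<phi> n))) summable_on UNIV"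
    and sn: "(\<lambda>n. norm (npart (etaD 0 0 0 n (P t) * \<phi> n))) summable_on UNIV" if "0 \<le> t" "t \<le> \<delta>" for t
    using summable_on_bounded_linear[OF bounded_linear_cpart sm[OF P[OF that]]]
      summable_on_bounded_linear[OF bounded_linear_npart sm[OF P[OF that]]]
    by (simp_all add: o_def summable_on_iff_abs_summable_on_complex)
  have c: "(\<lambda>n. W \<delta> n * norm (cpart (\<phi> n))) summable_on UNIV"
    using sc[of \<delta>] \<delta> by (simp add: norm_mult nc)
  define t where "t = \<delta> / 2"
  have t: "0 < t" "t < \<delta>" using \<delta> by (auto simp: t_def)
  have "\<exists>C\<ge>0. \<forall>n w'. norm (zeta w') \<le> norm (zeta w) + t \<and> \<bar>hx3 w'\<bar> \<le> \<bar>hx3 w\<bar> + t \<and> \<bar>hx4 w'\<bar> \<le> \<bar>hx4 w\<bar> + t \<longrightarrow>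
      norm (etaD 0 0 0 n w') \<le> C * W \<delta> n"
    unfolding W_def using t by (intro norm_etaD_le) auto
  then obtain C where C: "C \<ge> 0" "\<And>n. norm (etaD 0 0 0 n (P t)) \<le> C * W \<delta> n"
    using z[of t] x[of t] t by (metis less_imp_le order_refl)
  have "(\<lambda>n. norm (W t n * norm (npart (\<phi> n)))) summable_on UNIV"
  proof (rule Infinite_Sum.abs_summable_on_comparison_test')
    show "(\<lambda>n. norm (npart (etaD 0 0 0 n (P t) * \<phi> n)) + C * (W \<delta> n * norm (cpart (\<phi> n)))) summable_on UNIV"
      using t by (intro summable_on_add summable_on_cmult_right c sn) auto
    fix n
    define E where "E = etaD 0 0 0 n (P t)"
    \<comment> \<open>Here \<open>npart (E * \<phi> n)\<close> is
      \<open>cpart E * npart (\<phi> n)\<close> plus the mixed term; the mixed term is dominated by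
      the bound at the larger radii, already summable.\<close>
    have "norm (cpart E * npart (\<phi> n)) \<le> norm (npart (E * \<phi> n)) + norm (npart E * cnj (cpart (\<phi> n)))"
      using norm_triangle_ineq4[of "npart (E * \<phi> n)" "npart E * cnj (cpart (\<phi> n))"] by simp
    moreover have "norm (npart E * cnj (cpart (\<phi> n))) \<le> C * W \<delta> n * norm (cpart (\<phi> n))"
      unfolding norm_mult complex_mod_cnj E_def
      by (intro mult_right_mono order_trans[OF norm_npart_le C(2)]) auto
    moreover have "norm (W t n * norm (npart (\<phi> n))) = norm (cpart E * npart (\<phi> n))"
      using nc[of t n] t norm_ge_zero[of "cpart E"]
      by (simp add: E_def norm_mult abs_mult del: norm_ge_zero)
    ultimately show "norm (W t n * norm (npart (\<phi> n))) \<le>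
        norm (npart (etaD 0 0 0 n (P t) * \<phi> n)) + C * (W \<delta> n * norm (cpart (\<phi> n)))"
      by (simp only: E_def mult.assoc)
  qed
  hence n: "(\<lambda>n. W t n * norm (npart (\<phi> n))) summable_on UNIV"
    by (rule abs_summable_summable)
  have "(\<lambda>n. W t n * norm (\<phi> n)) summable_on UNIV"
  proof (rule summable_on_comparison_test)
    show "(\<lambda>n. W \<delta> n * norm (cpart (\<phi> n)) + W t n * norm (npart (\<phi> n))) summable_on UNIV"
      by (intro summable_on_add c n)
    fix n
    have W: "0 \<le> W t n" "W t n \<le> W \<delta> n"
      unfolding W_def using t by (auto intro!: box_weight_nonneg box_weight_mono)
    show "0 \<le> W t n * norm (\<phi> n)" using W by simp
    have "W t n * norm (\<phi> n) \<le> W t n * (norm (cpart (\<phi> n)) + norm (npart (\<phi> n)))"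
      by (intro mult_left_mono norm_hyp_le_parts W)
    also have "\<dots> \<le> W \<delta> n * norm (cpart (\<phi> n)) + W t n * norm (npart (\<phi> n))"
      using W by (simp add: distrib_left mult_right_mono)
    finally show "W t n * norm (\<phi> n) \<le> W \<delta> n * norm (cpart (\<phi> n)) + W t n * norm (npart (\<phi> n))" .
  qed
  thus ?thesis unfolding W_def using t
    by (intro exI[of _ "norm (zeta w) + t"] exI[of _ "\<bar>hx3 w\<bar> + t"] exI[of _ "\<bar>hx4 w\<bar> + t"]) auto
qed

subsection \<open>Power series in four real variables\<close>

text \<open>In finite dimension unordered summability is absolute; the two complex parts reduce this
  to the complex case.\<close>

lemma hyp_abs_summable:
  fixes f :: "'i \<Rightarrow> hyp"
  assumes "f summable_on A"
  shows "(\<lambda>n. norm (f n)) summable_on A"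
proof (rule summable_on_comparison_test)
  have "(\<lambda>n. norm (cpart (f n))) summable_on A" "(\<lambda>n. norm (npart (f n))) summable_on A"
    using summable_on_bounded_linear[OF bounded_linear_cpart assms]
      summable_on_bounded_linear[OF bounded_linear_npart assms]
    by (simp_all add: o_def summable_on_iff_abs_summable_on_complex)
  thus "(\<lambda>n. norm (cpart (f n)) + norm (npart (f n))) summable_on A"
    by (rule summable_on_add)
qed (simp_all add: norm_hyp_le_parts)

type_synonym midx = "nat \<times> nat \<times> nat \<times> nat"

definition mon :: "midx \<Rightarrow> hyp \<Rightarrow> real" where
  "mon n x = (case n of (a, b, c, d) \<Rightarrow> hx1 x ^ a * hx2 x ^ b * hx3 x ^ c * hx4 x ^ d)"

definition mdeg :: "midx \<Rightarrow> nat" where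
  "mdeg n = (case n of (a, b, c, d) \<Rightarrow> a + b + c + d)"

definition has_pseries :: "(midx \<Rightarrow> hyp) \<Rightarrow> (hyp \<Rightarrow> hyp) \<Rightarrow> hyp \<Rightarrow> bool" where
  "has_pseries c f p \<longleftrightarrow> (\<forall>\<^sub>F w in nhds p. ((\<lambda>n. mon n (w - p) *\<^sub>R c n) has_sum f w) UNIV)"

definition cube :: "real \<Rightarrow> hyp set" where
  "cube r = {x. \<bar>hx1 x\<bar> < r \<and> \<bar>hx2 x\<bar> < r \<and> \<bar>hx3 x\<bar> < r \<and> \<bar>hx4 x\<bar> < r}"

lemma R_analytic_at_iff: "R_analytic_at f p \<longleftrightarrow> (\<exists>c. has_pseries c f p)"
  unfolding R_analytic_at_def has_pseries_def mon_def by (simp add: case_prod_unfold)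

lemma norm_hyp_le_sum: "norm x \<le> \<bar>hx1 x\<bar> + \<bar>hx2 x\<bar> + \<bar>hx3 x\<bar> + \<bar>hx4 x\<bar>"
  using norm_hyp_le_parts[of x] cmod_le[of "cpart x"] cmod_le[of "npart x"]
  by (simp add: cpart_def npart_def)

lemma eventually_cube:
  assumes "r > 0"
  shows "eventually (\<lambda>w. w - p \<in> cube r) (nhds p)"
proof -
  have "w - p \<in> cube r" if "dist w p < r" for w
    using that abs_hyp_sel_le[of "w - p"] by (auto simp: cube_def dist_norm)
  thus ?thesis using assms unfolding eventually_nhds_metric by blast
qed

lemma cube_eq: "cube r = hx1 -` ball 0 r \<inter> hx2 -` ball 0 r \<inter> hx3 -` ball 0 r \<inter> hx4 -` ball 0 r"
  by (auto simp: cube_def)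

lemma open_cube: "open (cube r)"
  unfolding cube_eq
  by (intro open_Int open_vimage open_ball linear_continuous_on bounded_linear_hyp_sel)

lemma convex_cube: "convex (cube r)"
  unfolding cube_eq
  by (intro convex_Int convex_linear_vimage convex_ball bounded_linear.linear bounded_linear_hyp_sel)

lemma has_pseries_radius:
  assumes "has_pseries c f p"
  obtains r where "r > 0" "(\<lambda>n. r ^ mdeg n * norm (c n)) summable_on UNIV"
    "\<And>w. w - p \<in> cube r \<Longrightarrow> ((\<lambda>n. mon n (w - p) *\<^sub>R c n) has_sum f w) UNIV"
proof -
  obtain e where e: "e > 0" "\<And>w. dist w p < e \<Longrightarrow> ((\<lambda>n. mon n (w - p) *\<^sub>R c n) has_sum f w) UNIV"
    using assms unfolding has_pseries_def eventually_nhds_metric by blast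
  \<comment> \<open>At the diagonal point \<open>q\<close> every monomial equals
    \<open>r ^ mdeg n\<close>, so convergence at this one point bounds all coefficients. With four
    coordinates, \<open>e / 5\<close> keeps \<open>q\<close> and the cube within distance
    \<open>e\<close>.\<close>
  define r where "r = e / 5"
  define q where "q = Hyp r r r r"
  have r: "r > 0" using e by (simp add: r_def)
  have "dist (p + q) p < e"
    using norm_hyp_le_sum[of q] e(1) by (simp add: q_def r_def dist_norm)
  from e(2)[OF this] have "(\<lambda>n. mon n q *\<^sub>R c n) summable_on UNIV"
    by (auto simp: summable_on_def)
  hence "(\<lambda>n. norm (mon n q *\<^sub>R c n)) summable_on UNIV" by (rule hyp_abs_summable)
  moreover have "norm (mon n q *\<^sub>R c n) = r ^ mdeg n * norm (c n)" for n
    using r by (cases n) (simp add: mon_def mdeg_def q_def power_add abs_mult)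
  ultimately have "(\<lambda>n. r ^ mdeg n * norm (c n)) summable_on UNIV" by (simp only:)
  moreover have "((\<lambda>n. mon n (w - p) *\<^sub>R c n) has_sum f w) UNIV" if "w - p \<in> cube r" for w
    using that norm_hyp_le_sum[of "w - p"] r by (intro e(2)) (auto simp: cube_def dist_norm r_def)
  ultimately show ?thesis using that r by blast
qed

lemma has_pseriesI:
  assumes "r > 0" "\<And>w. w - p \<in> cube r \<Longrightarrow> ((\<lambda>n. mon n (w - p) *\<^sub>R c n) has_sum f w) UNIV"
  shows "has_pseries c f p"
  unfolding has_pseries_def using eventually_cube[OF assms(1)] by (rule eventually_mono) (rule assms(2))

section \<open>Partial derivatives of power series\<close>

definition midx_nth :: "hyp \<Rightarrow> midx \<Rightarrow> nat" where
  "midx_nth e n = (case n of (a, b, c, d) \<Rightarrow> if e = 1 then a else if e = hi then b else if e = hj then c else d)"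

definition midx_inc :: "hyp \<Rightarrow> midx \<Rightarrow> midx" where
  "midx_inc e n = (case n of (a, b, c, d) \<Rightarrow> if e = 1 then (Suc a, b, c, d) else if e = hi then (a, Suc b, c, d)
     else if e = hj then (a, b, Suc c, d) else (a, b, c, Suc d))"

definition dmon :: "hyp \<Rightarrow> midx \<Rightarrow> hyp \<Rightarrow> real" where
  "dmon e n x = (case n of (a, b, c, d) \<Rightarrow>
     if e = 1 then of_nat a * hx1 x ^ (a - 1) * (hx2 x ^ b * hx3 x ^ c * hx4 x ^ d)
     else if e = hi then of_nat b * hx2 x ^ (b - 1) * (hx1 x ^ a * hx3 x ^ c * hx4 x ^ d)
     else if e = hj then of_nat c * hx3 x ^ (c - 1) * (hx1 x ^ a * hx2 x ^ b * hx4 x ^ d)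
     else of_nat d * hx4 x ^ (d - 1) * (hx1 x ^ a * hx2 x ^ b * hx3 x ^ c))"

lemma hyp_basis_neq [simp]:
  "hi \<noteq> 1" "hj \<noteq> 1" "hk \<noteq> 1" "hj \<noteq> hi" "hk \<noteq> hi" "hk \<noteq> hj"
  "1 \<noteq> hi" "1 \<noteq> hj" "1 \<noteq> hk" "hi \<noteq> hj" "hi \<noteq> hk" "hj \<noteq> hk"
  by (simp_all add: hi_def hj_def hk_def hyp_eq_iff)

lemma has_derivative_hyp_sel:
  "(hx1 has_derivative hx1) (at x)" "(hx2 has_derivative hx2) (at x)"
  "(hx3 has_derivative hx3) (at x)" "(hx4 has_derivative hx4) (at x)"
  by (intro bounded_linear_imp_has_derivative bounded_linear_hyp_sel)+

lemma has_derivative_mon: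
  "(mon n has_derivative (\<lambda>h. hx1 h * dmon 1 n x + hx2 h * dmon hi n x + hx3 h * dmon hj n x + hx4 h * dmon hk n x)) (at x)"
proof -
  obtain a b c d where n: "n = (a, b, c, d)" by (cases n)
  have "((\<lambda>x. hx1 x ^ a * hx2 x ^ b * hx3 x ^ c * hx4 x ^ d) has_derivative
      (\<lambda>h. hx1 h * dmon 1 n x + hx2 h * dmon hi n x + hx3 h * dmon hj n x + hx4 h * dmon hk n x)) (at x)"
    by (rule derivative_eq_intros has_derivative_hyp_sel refl | simp add: fun_eq_iff dmon_def n algebra_simps)+
  thus ?thesis by (simp add: mon_def[abs_def] n)
qed

text \<open>Halving the radius pays for the exponent produced by differentiation:
  \<open>k \<le> 2 ^ k\<close> gives
  \<open>k * (r / 2) ^ (k - 1) \<le> 2 / r * r ^ k\<close>.\<close>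

lemma abs_dmon_le:
  assumes "r > 0" "x \<in> cube (r / 2)"
  shows "\<bar>dmon e n x\<bar> \<le> 2 / r * r ^ mdeg n"
proof -
  have D: "\<bar>of_nat k * t ^ (k - 1)\<bar> \<le> 2 / r * r ^ k" if "\<bar>t\<bar> < r / 2" for t :: real and k :: nat
  proof (cases k)
    case 0
    thus ?thesis using assms by simp
  next
    case (Suc m)
    have "\<bar>of_nat k * t ^ (k - 1)\<bar> \<le> real k * (r / 2) ^ m"
      using that Suc by (auto simp: abs_mult power_abs intro!: mult_left_mono power_mono simp del: of_nat_Suc)
    also have "\<dots> \<le> 2 ^ k * (r / 2) ^ m"
      using assms of_nat_less_two_power[of k, where 'a=real] by (intro mult_right_mono) auto
    also have "\<dots> = 2 / r * r ^ k" using assms Suc by (simp add: power_divide field_simps)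
    finally show ?thesis .
  qed
  have P: "\<bar>t ^ k\<bar> \<le> r ^ k" if "\<bar>t\<bar> < r / 2" for t :: real and k :: nat
    using that assms by (auto simp: power_abs intro!: power_mono)
  obtain a b c d where n: "n = (a, b, c, d)" by (cases n)
  have X: "\<bar>hx1 x\<bar> < r / 2" "\<bar>hx2 x\<bar> < r / 2" "\<bar>hx3 x\<bar> < r / 2" "\<bar>hx4 x\<bar> < r / 2"
    using assms by (auto simp: cube_def)
  have G: "\<bar>of_nat k * t ^ (k - 1) * (t1 ^ k1 * t2 ^ k2 * t3 ^ k3)\<bar> \<le> 2 / r * r ^ (k + k1 + k2 + k3)"
    if "\<bar>t\<bar> < r / 2" "\<bar>t1\<bar> < r / 2" "\<bar>t2\<bar> < r / 2" "\<bar>t3\<bar> < r / 2" for t t1 t2 t3 :: real and k k1 k2 k3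
  proof -
    have "\<bar>of_nat k * t ^ (k - 1) * (t1 ^ k1 * t2 ^ k2 * t3 ^ k3)\<bar> \<le> (2 / r * r ^ k) * (r ^ k1 * r ^ k2 * r ^ k3)"
      unfolding abs_mult[of "of_nat k * t ^ (k - 1)"] abs_mult[of "t1 ^ k1 * t2 ^ k2"] abs_mult[of "t1 ^ k1"]
      using assms by (intro mult_mono D P that mult_nonneg_nonneg) auto
    thus ?thesis by (simp add: power_add mult.assoc)
  qed
  consider "e = 1" | "e = hi" | "e = hj" | "e \<noteq> 1" "e \<noteq> hi" "e \<noteq> hj" by blast
  thus ?thesis
  proof cases
    case 1 show ?thesis using G[OF X(1) X(2) X(3) X(4), of a b c d] 1 by (simp add: n dmon_def mdeg_def)
  next
    case 2 show ?thesis using G[OF X(2) X(1) X(3) X(4), of b a c d] 2 by (simp add: n dmon_def mdeg_def add_ac)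
  next
    case 3 show ?thesis using G[OF X(3) X(1) X(2) X(4), of c a b d] 3 by (simp add: n dmon_def mdeg_def add_ac)
  next
    case 4 show ?thesis using G[OF X(4) X(1) X(2) X(3), of d a b c] 4 by (simp add: n dmon_def mdeg_def add_ac)
  qed
qed

lemma inj_midx_inc: "inj (midx_inc e)"
  by (auto simp: inj_def midx_inc_def split: if_splits)

lemma dmon_inc: "dmon e (midx_inc e n) x = (real (midx_nth e n) + 1) * mon n x"
  by (cases n) (auto simp: dmon_def midx_inc_def midx_nth_def mon_def algebra_simps)

lemma dmon_eq_0:
  assumes "n \<notin> range (midx_inc e)"
  shows "dmon e n x = 0"
proof -
  obtain a b c d where n: "n = (a, b, c, d)" by (cases n)
  have *: "n \<noteq> midx_inc e m" for m using assms by blast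
  show ?thesis
    using *[of "(a - 1, b, c, d)"] *[of "(a, b - 1, c, d)"] *[of "(a, b, c - 1, d)"] *[of "(a, b, c, d - 1)"]
    by (auto simp: n midx_inc_def dmon_def split: if_splits)
qed

definition dcoeff :: "hyp \<Rightarrow> (midx \<Rightarrow> hyp) \<Rightarrow> midx \<Rightarrow> hyp" where
  "dcoeff e c n = (real (midx_nth e n) + 1) *\<^sub>R c (midx_inc e n)"

lemma has_pseries_partial:
  assumes "has_pseries c f p" "e \<in> {1, hi, hj, hk}"
  shows "has_pseries (dcoeff e c) (partial e f) p"
proof -
  obtain r where r: "r > 0" "(\<lambda>n. r ^ mdeg n * norm (c n)) summable_on UNIV"
    "\<And>w. w - p \<in> cube r \<Longrightarrow> ((\<lambda>n. mon n (w - p) *\<^sub>R c n) has_sum f w) UNIV"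
    using has_pseries_radius[OF assms(1)] by blast
  define S where "S = (\<lambda>x. x - p) -` cube (r / 2)"
  have "S = (\<lambda>x. p + x) ` cube (r / 2)" unfolding S_def by (auto intro: image_eqI[of _ _ "_ - p"])
  hence S: "open S" "convex S" by (simp_all add: open_translation open_cube convex_translation convex_cube)
  define F' where "F' n y h = (hx1 h * dmon 1 n (y - p) + hx2 h * dmon hi n (y - p) + hx3 h * dmon hj n (y - p)
      + hx4 h * dmon hk n (y - p)) *\<^sub>R c n" for n y h
  have D: "((\<lambda>y. mon n (y - p) *\<^sub>R c n) has_derivative F' n y) (at y)" for n y
  proof -
    have "((\<lambda>y. y - p) has_derivative (\<lambda>h. h)) (at y)" by (auto intro!: derivative_eq_intros)
    from has_derivative_compose[OF this has_derivative_mon]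
    show ?thesis unfolding F'_def by (rule has_derivative_scaleR_left)
  qed
  \<comment> \<open>The constant is four coordinate directions times the 2 of
    \<open>abs_dmon_le\<close>.\<close>
  have B: "norm (F' n y h) \<le> (8 / r * (r ^ mdeg n * norm (c n))) * norm h" if "y \<in> S" for n y h
  proof -
    define M where "M = 2 / r * r ^ mdeg n"
    have M: "\<bar>x * dmon e n (y - p)\<bar> \<le> norm h * M" if "\<bar>x\<bar> \<le> norm h" for x e
      using abs_dmon_le[OF r(1), of "y - p" e n] \<open>y \<in> S\<close> that r(1) unfolding M_def S_def abs_mult
      by (intro mult_mono) auto
    have "\<bar>hx1 h * dmon 1 n (y - p) + hx2 h * dmon hi n (y - p) + hx3 h * dmon hj n (y - p)
      + hx4 h * dmon hk n (y - p)\<bar> \<le> 4 * (norm h * M)"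
      using M[OF abs_hyp_sel_le(1), of 1] M[OF abs_hyp_sel_le(2), of hi] M[OF abs_hyp_sel_le(3), of hj]
        M[OF abs_hyp_sel_le(4), of hk] by linarith
    hence "norm (F' n y h) \<le> 4 * (norm h * M) * norm (c n)"
      unfolding F'_def norm_scaleR by (rule mult_right_mono) simp
    thus ?thesis by (simp add: M_def mult_ac)
  qed
  have "((\<lambda>n. mon n (w - p) *\<^sub>R dcoeff e c n) has_sum partial e f w) UNIV" if w: "w - p \<in> cube (r / 2)" for w
  proof -
    have "w \<in> S" using w by (simp add: S_def)
    have hs: "((\<lambda>n. mon n (y - p) *\<^sub>R c n) has_sum f y) UNIV" if "y \<in> S" for y
      using that r(1) by (intro r(3)) (auto simp: S_def cube_def)
    note T = has_derivative_infsum[OF S \<open>w \<in> S\<close> D B summable_on_cmult_right[OF r(2)] hs, simplified]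
    have "F' n w e = dmon e n (w - p) *\<^sub>R c n" for n
      using assms(2) by (auto simp: F'_def hi_def[symmetric]) (simp_all add: hi_def hj_def hk_def)
    hence "((\<lambda>n. dmon e n (w - p) *\<^sub>R c n) has_sum partial e f w) UNIV"
      using partial_eq[OF T(1), of e] has_sum_infsum[OF T(2), of e] by simp
    \<comment> \<open>Monomials of exponent 0 in direction \<open>e\<close> have derivative 0, so
      the sum lives on the range of \<open>midx_inc e\<close>; pulling it back along this injection
      produces \<open>dcoeff\<close>.\<close>
    also have "?this \<longleftrightarrow> ((\<lambda>n. dmon e n (w - p) *\<^sub>R c n) has_sum partial e f w) (range (midx_inc e))"
      by (rule has_sum_cong_neutral) (auto simp: dmon_eq_0)
    also have "\<dots> \<longleftrightarrow> ((\<lambda>n. dmon e (midx_inc e n) (w - p) *\<^sub>R c (midx_inc e n)) has_sum partial e f w) UNIV"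
      using has_sum_reindex[OF inj_midx_inc[of e], of "\<lambda>n. dmon e n (w - p) *\<^sub>R c n"] by (simp add: o_def)
    finally show ?thesis by (simp add: dmon_inc dcoeff_def mult_ac)
  qed
  thus ?thesis using r(1) by (intro has_pseriesI[of "r / 2"]) auto
qed

lemma has_pseries_funpow_partial:
  assumes "has_pseries c f p" "e \<in> {1, hi, hj, hk}"
  shows "has_pseries (\<lambda>n. (fact (midx_nth e n + k) / fact (midx_nth e n)) *\<^sub>R c ((midx_inc e ^^ k) n))
    ((partial e ^^ k) f) p"
proof (induction k)
  case 0
  thus ?case using assms by simp
next
  case (Suc k)
  have inc: "midx_nth e (midx_inc e n) = Suc (midx_nth e n)" for n
    by (auto simp: midx_nth_def midx_inc_def split: prod.splits if_splits)
  have "dcoeff e (\<lambda>n. (fact (midx_nth e n + k) / fact (midx_nth e n)) *\<^sub>R c ((midx_inc e ^^ k) n)) =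
      (\<lambda>n. (fact (midx_nth e n + Suc k) / fact (midx_nth e n)) *\<^sub>R c ((midx_inc e ^^ Suc k) n))"
  proof
    fix n
    have "(real (midx_nth e n) + 1) * (fact (Suc (midx_nth e n) + k) / fact (Suc (midx_nth e n)))
        = fact (midx_nth e n + Suc k) / fact (midx_nth e n)"
    proof -
      have "fact (Suc m) = (real m + 1) * fact m" and "real m + 1 \<noteq> 0" for m by simp_all
      thus ?thesis by (simp only: add_Suc_shift) (simp del: fact_Suc)
    qed
    moreover have "(midx_inc e ^^ k) (midx_inc e n) = (midx_inc e ^^ Suc k) n"
      by (simp only: funpow_Suc_right o_apply)
    ultimately show "dcoeff e (\<lambda>n. (fact (midx_nth e n + k) / fact (midx_nth e n)) *\<^sub>R c ((midx_inc e ^^ k) n)) n =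
      (fact (midx_nth e n + Suc k) / fact (midx_nth e n)) *\<^sub>R c ((midx_inc e ^^ Suc k) n)"
      unfolding dcoeff_def inc scaleR_scaleR by (simp only:)
  qed
  thus ?case using has_pseries_partial[OF Suc assms(2)] by simp
qed

lemma has_pseries_at:
  assumes "has_pseries c f p"
  shows "f p = c (0, 0, 0, 0)"
proof -
  have "((\<lambda>n. mon n (p - p) *\<^sub>R c n) has_sum f p) UNIV"
    using assms unfolding has_pseries_def by (rule eventually_nhds_x_imp_x)
  also have "?this \<longleftrightarrow> ((\<lambda>n. c n) has_sum f p) {(0, 0, 0, 0)}"
    by (rule has_sum_cong_neutral) (auto simp: mon_def)
  finally show ?thesis using has_sum_unique[OF has_sum_finite[of "{(0, 0, 0, 0)}" c]] by fastforce
qed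

text \<open>Taylor's formula at the origin, for the coefficients free of \<open>x\<^sub>1\<close>:
  these determine \<open>f\<close> near 0 on the hyperplane \<open>x\<^sub>1 = 0\<close>.\<close>

lemma eta_coeff_eq:
  assumes "has_pseries c f 0"
  shows "eta_coeff f (n1, n2, n3) = (fact n1 * fact n2 * fact n3) *\<^sub>R c (0, n1, n2, n3)"
proof -
  have inc: "(midx_inc hi ^^ k) (a, b, m, n) = (a, b + k, m, n)" "(midx_inc hj ^^ k) (a, b, m, n) = (a, b, m + k, n)"
    "(midx_inc hk ^^ k) (a, b, m, n) = (a, b, m, n + k)" for k a b m n
    by (induction k) (auto simp: midx_inc_def)
  note P = has_pseries_funpow_partial[where e = hi and k = n1, OF has_pseries_funpow_partial[where e = hj and k = n2,
        OF has_pseries_funpow_partial[where e = hk and k = n3, OF assms]]]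
  show ?thesis
    using has_pseries_at[OF P] by (simp add: inc midx_nth_def mult_ac)
qed

lemma R_analytic_at_nabla0:
  assumes "R_analytic_at f p"
  shows "R_analytic_at (nabla0 f) p"
proof -
  obtain c where c: "has_pseries c f p" using assms by (auto simp: R_analytic_at_iff)
  have "has_pseries (\<lambda>n. dcoeff 1 c n + hi * dcoeff hi c n + hj * dcoeff hj c n + hk * dcoeff hk c n) (nabla0 f) p"
    using has_pseries_partial[OF c, of 1, simplified] has_pseries_partial[OF c, of hi, simplified]
      has_pseries_partial[OF c, of hj, simplified] has_pseries_partial[OF c, of hk, simplified]
    unfolding has_pseries_def
  proof eventually_elim
    case (elim w)
    show ?case unfolding nabla0_def
      using has_sum_add[OF has_sum_add[OF has_sum_add[OF elim(1) has_sum_hyp_mult_left[OF elim(2), of hi]]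
        has_sum_hyp_mult_left[OF elim(3), of hj]] has_sum_hyp_mult_left[OF elim(4), of hk]]
      by (simp add: scaleR_add_right)
  qed
  thus ?thesis by (auto simp: R_analytic_at_iff)
qed

subsection \<open>The identity theorem\<close>

text \<open>The semi-norm is the modulus of \<open>cpart\<close>, so its balls are cylinders over
  complex discs; every open set is a union of full fibres of \<open>cpart\<close>.\<close>

lemma openin_hyp_topology_iff:
  "openin hyp_topology U \<longleftrightarrow> open U \<and> (\<forall>w\<in>U. \<forall>v. cpart v = cpart w \<longrightarrow> v \<in> U)"
proof
  assume "openin hyp_topology U"
  hence "generate_topology_on {B. \<exists>p r. r > 0 \<and> B = {w. hyp_seminorm (w - p) < r}} U"
    unfolding hyp_topology_def openin_topology_generated_by_iff .
  thus "open U \<and> (\<forall>w\<in>U. \<forall>v. cpart v = cpart w \<longrightarrow> v \<in> U)"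
  proof induction
    case (Basis B)
    then obtain p r where B: "B = {w. hyp_seminorm (w - p) < r}" by blast
    have "hyp_seminorm w = norm (cpart w)" for w
      by (simp add: hyp_seminorm_def cpart_def cmod_def)
    hence B': "B = (\<lambda>w. cpart w) -` ball (cpart p) r"
      unfolding B using bounded_linear_cpart
      by (auto simp: dist_norm linear_diff bounded_linear.linear norm_minus_commute)
    have "open B" unfolding B'
      by (intro open_vimage open_ball linear_continuous_on bounded_linear_cpart)
    thus ?case unfolding B' by simp
  next
    case (UN K)
    hence "open (\<Union>K)" by (intro open_Union) blast
    thus ?case using UN.IH by blast
  qed auto
next
  assume U: "open U \<and> (\<forall>w\<in>U. \<forall>v. cpart v = cpart w \<longrightarrow> v \<in> U)"
  show "openin hyp_topology U"
  proof (subst openin_subopen, intro ballI)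
    fix w assume w: "w \<in> U"
    then obtain e where e: "e > 0" "ball w e \<subseteq> U" using U open_contains_ball by blast
    define T where "T = {v. hyp_seminorm (v - w) < e}"
    have "openin hyp_topology T"
      unfolding hyp_topology_def T_def using e by (intro topology_generated_by_Basis) auto
    moreover have "w \<in> T" using e by (simp add: T_def hyp_seminorm_def)
    moreover have "T \<subseteq> U"
    proof
      fix v assume v: "v \<in> T"
      \<comment> \<open>Taking the nilpotent coordinates from \<open>w\<close> makes the Euclidean
        distance to \<open>w\<close> equal to the semi-norm distance; saturation then leads back to
        \<open>v\<close>.\<close>
      define v' where "v' = Hyp (hx1 v) (hx2 v) (hx3 w) (hx4 w)"
      have "norm (v' - w) = hyp_seminorm (v - w)"
        by (simp add: v'_def norm_hyp_def inner_hyp_def hyp_seminorm_def power2_eq_square)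
      hence "v' \<in> U" using v e by (auto simp: T_def dist_norm norm_minus_commute subset_iff)
      thus "v \<in> U" using U by (auto simp: v'_def cpart_def)
    qed
    ultimately show "\<exists>T. openin hyp_topology T \<and> w \<in> T \<and> T \<subseteq> U" by blast
  qed
qed

text \<open>The fibres of \<open>cpart\<close> are convex, hence connected, so neither side of a
  Euclidean separation can cut one. Both sides are therefore saturated and separate \<open>U\<close>
  in the coarser topology too.\<close>

lemma connected_if_connectedin_hyp_topology:
  assumes "openin hyp_topology U" "connectedin hyp_topology U"
  shows "connected U"
proof (rule connectedI)
  fix A B assume AB: "open A" "open B" "A \<inter> U \<noteq> {}" "B \<inter> U \<noteq> {}" "A \<inter> B \<inter> U = {}" "U \<subseteq> A \<union> B"
  have U: "open U" "\<And>w v. w \<in> U \<Longrightarrow> cpart v = cpart w \<Longrightarrow> v \<in> U"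
    using assms(1) by (auto simp: openin_hyp_topology_iff)
  have sat: "openin hyp_topology (C \<inter> U)"
    if C: "open C" "open D" "C \<inter> D \<inter> U = {}" "U \<subseteq> C \<union> D" for C D
    unfolding openin_hyp_topology_iff
  proof (intro conjI ballI allI impI)
    show "open (C \<inter> U)" using C U by auto
    fix w v assume w: "w \<in> C \<inter> U" and v: "cpart v = cpart w"
    define L where "L = cpart -` {cpart w}"
    have "convex L" unfolding L_def
      by (intro convex_linear_vimage convex_singleton bounded_linear.linear bounded_linear_cpart)
    hence "connected L" by (rule convex_connected)
    moreover have LU: "L \<subseteq> U" using U(2) w by (auto simp: L_def)
    ultimately have "D \<inter> L = {}"
      using connectedD[of L C D] C w by (auto simp: L_def)
    moreover have "v \<in> L" using v by (simp add: L_def)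
    ultimately show "v \<in> C \<inter> U" using C LU by blast
  qed
  have "openin hyp_topology (A \<inter> U)" "openin hyp_topology (B \<inter> U)"
    using sat[of A B] sat[of B A] AB by (auto simp: Int_commute)
  moreover have "U \<subseteq> (A \<inter> U) \<union> (B \<inter> U)" "(A \<inter> U) \<inter> (B \<inter> U) \<inter> U = {}"
    "(A \<inter> U) \<inter> U \<noteq> {}" "(B \<inter> U) \<inter> U \<noteq> {}" using AB by auto
  ultimately show False using assms(2) unfolding connectedin by blast
qed

text \<open>Complexifying the parameter of the line through \<open>q\<close> and \<open>w\<close> makes the series holomorphic.\<close>

lemma line_power_series_zero:
  fixes \<gamma> :: "midx \<Rightarrow> complex"
  assumes sm: "(\<lambda>n. r ^ mdeg n * norm (\<gamma> n)) summable_on UNIV"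
    and qw: "q \<in> cube r" "w \<in> cube r"
    and G: "\<And>t. q + t *\<^sub>R (w - q) \<in> cube r \<Longrightarrow> ((\<lambda>n. mon n (q + t *\<^sub>R (w - q)) *\<^sub>R \<gamma> n) has_sum G t) UNIV"
    and ev: "eventually (\<lambda>t. G t = 0) (at_right 0)"
  shows "G 1 = 0"
proof -
  define X where "X s t = of_real (s q) + t * of_real (s (w - q))" for s :: "hyp \<Rightarrow> real" and t :: complex
  define cm where "cm n t = (case n of (a, b, c, d) \<Rightarrow> X hx1 t ^ a * X hx2 t ^ b * X hx3 t ^ c * X hx4 t ^ d)"
    for n :: midx and t
  define S where "S = {t. norm (X hx1 t) < r \<and> norm (X hx2 t) < r \<and> norm (X hx3 t) < r \<and> norm (X hx4 t) < r}"
  define \<Phi> where "\<Phi> t = (\<Sum>\<^sub>\<infinity>n. cm n t * \<gamma> n)" for t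
  have r: "0 \<le> r" using qw by (auto simp: cube_def)
  have S_eq: "S = X hx1 -` ball 0 r \<inter> X hx2 -` ball 0 r \<inter> X hx3 -` ball 0 r \<inter> X hx4 -` ball 0 r"
    by (auto simp: S_def)
  have oX: "open (X s -` ball 0 r)" for s
    unfolding X_def by (intro open_vimage open_ball continuous_intros)
  hence "open S" unfolding S_eq by (intro open_Int)
  have cX: "convex (X s -` ball 0 r)" for s
  proof (rule convexI)
    fix x y u v assume xy: "x \<in> X s -` ball 0 r" "y \<in> X s -` ball 0 r" and uv: "0 \<le> u" "0 \<le> v" "u + v = (1::real)"
    have "X s (u *\<^sub>R x + v *\<^sub>R y) = (u + v) *\<^sub>R of_real (s q) + (u *\<^sub>R x + v *\<^sub>R y) * of_real (s (w - q))"
      using uv by (simp add: X_def)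
    also have "\<dots> = u *\<^sub>R X s x + v *\<^sub>R X s y"
      by (simp add: X_def algebra_simps)
    also have "\<dots> \<in> ball 0 r"
      using convexD[OF convex_ball, of "X s x" 0 r "X s y" u v] xy uv by simp
    finally show "u *\<^sub>R x + v *\<^sub>R y \<in> X s -` ball 0 r" by simp
  qed
  have cS: "convex S" unfolding S_eq by (intro convex_Int cX)
  have Xr: "X s (of_real t) = of_real (s (q + t *\<^sub>R (w - q)))" if "linear s" for s t
    using that by (simp add: X_def linear_add linear_scale)
  note lin = bounded_linear_hyp_sel[THEN bounded_linear.linear]
  have S_real: "of_real t \<in> S \<longleftrightarrow> q + t *\<^sub>R (w - q) \<in> cube r" for t
    by (simp add: S_def cube_def Xr lin del: hyp_sel_simps)
  have cmr: "cm n (of_real t) = of_real (mon n (q + t *\<^sub>R (w - q)))" for n t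
    by (cases n) (simp add: cm_def mon_def Xr lin del: hyp_sel_simps)
  have \<Phi>G: "\<Phi> (of_real t) = G t" if "of_real t \<in> S" for t
    using G[OF that[unfolded S_real]] by (simp add: \<Phi>_def cmr infsumI scaleR_conv_of_real)
  have cmB: "norm (cm n t * \<gamma> n) \<le> r ^ mdeg n * norm (\<gamma> n)" if "t \<in> S" for n t
  proof -
    obtain a b c d where n: "n = (a, b, c, d)" by (cases n)
    have "norm (cm n t) \<le> r ^ a * r ^ b * r ^ c * r ^ d"
      using that r unfolding n cm_def S_def
      by (auto simp: norm_mult norm_power intro!: mult_mono power_mono)
    thus ?thesis by (simp add: norm_mult n mdeg_def power_add mult_right_mono)
  qed
  have hol: "\<Phi> holomorphic_on S"
    unfolding holomorphic_on_def
  proof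
    fix z assume "z \<in> S"
    then obtain \<rho> where \<rho>: "\<rho> > 0" "cball z \<rho> \<subseteq> S" using \<open>open S\<close> open_contains_cball by blast
    \<comment> \<open>The majorant is independent of the parameter, so the finite partial sums
      converge uniformly and the limit inherits holomorphy.\<close>
    have ul: "uniform_limit (cball z \<rho>) (\<lambda>F t. \<Sum>n\<in>F. cm n t * \<gamma> n) \<Phi> (finite_subsets_at_top UNIV)"
      unfolding \<Phi>_def by (rule Weierstrass_m_test_general[OF _ sm]) (use cmB \<rho> in auto)
    have hol: "(\<lambda>t. \<Sum>n\<in>F. cm n t * \<gamma> n) holomorphic_on A" for F A
      unfolding cm_def X_def by (intro holomorphic_intros) (auto split: prod.splits intro!: holomorphic_intros)
    hence ev: "\<forall>\<^sub>F F in finite_subsets_at_top UNIV. continuous_on (cball z \<rho>) (\<lambda>t. \<Sum>n\<in>F. cm n t * \<gamma> n) \<and>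
        (\<lambda>t. \<Sum>n\<in>F. cm n t * \<gamma> n) holomorphic_on ball z \<rho>"
      by (simp add: holomorphic_on_imp_continuous_on)
    have "\<Phi> holomorphic_on ball z \<rho>"
      by (rule holomorphic_uniform_limit[OF ev ul finite_subsets_at_top_neq_bot])
    hence "\<Phi> field_differentiable at z"
      using \<rho> by (simp add: holomorphic_on_imp_differentiable_at)
    thus "\<Phi> field_differentiable at z within S" by (rule field_differentiable_at_within)
  qed
  have S01: "of_real t \<in> S" if "0 \<le> t" "t \<le> 1" for t
  proof -
    have "(1 - t) *\<^sub>R of_real 0 + t *\<^sub>R of_real 1 \<in> S"
      using qw that S_real[of 0] S_real[of 1] by (intro convexD[OF cS]) auto
    thus ?thesis by (simp add: scaleR_conv_of_real)
  qed
  obtain \<epsilon> where \<epsilon>: "\<epsilon> > 0" "\<And>t. 0 < t \<Longrightarrow> t < \<epsilon> \<Longrightarrow> G t = 0"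
    using ev unfolding eventually_at_right_field by auto
  \<comment> \<open>One-sided zeros are enough: they accumulate at 0, an interior point of the
    connected set \<open>S\<close>.\<close>
  define Z :: "complex set" where "Z = of_real ` {t. 0 < t \<and> t < min 1 \<epsilon>}"
  have lim: "(0::complex) islimpt Z"
    unfolding islimpt_approachable
  proof (intro allI impI)
    fix e :: real assume e: "e > 0"
    define t where "t = min (e / 2) (min 1 \<epsilon> / 2)"
    have t: "0 < t" "t < min 1 \<epsilon>" "t < e" using e \<epsilon> by (auto simp: t_def)
    hence "of_real t \<in> Z" unfolding Z_def by blast
    thus "\<exists>x'\<in>Z. x' \<noteq> 0 \<and> dist x' 0 < e" using t by (intro bexI[of _ "of_real t"]) auto
  qed
  have ZS: "Z \<subseteq> S" using S01 by (auto simp: Z_def)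
  have Z0: "\<Phi> z = 0" if "z \<in> Z" for z
    using that \<epsilon> \<Phi>G S01 by (auto simp: Z_def)
  have "0 \<in> S" "of_real 1 \<in> S" using S01[of 0] S01[of 1] by auto
  hence "\<Phi> (of_real 1) = 0"
    by (intro analytic_continuation[OF hol \<open>open S\<close> convex_connected[OF cS] ZS _ lim Z0])
  thus ?thesis using \<Phi>G[of 1] S01[of 1] by simp
qed

text \<open>Vanishing near a point is a locally constant property. If it holds at any
  \<open>q\<close> in the cube of convergence around \<open>p\<close>, the segment from
  \<open>q\<close> to another point of the cube carries the zero there; \<open>cpart\<close> and
  \<open>npart\<close> are treated separately to have complex values.\<close>

lemma R_analytic_identity:
  assumes U: "open U" "connected U" and an: "\<And>p. p \<in> U \<Longrightarrow> R_analytic_at g p"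
    and z: "z \<in> U" "eventually (\<lambda>w. g w = 0) (nhds z)" and w: "w \<in> U"
  shows "g w = 0"
proof -
  have "eventually (\<lambda>v. g v = 0) (nhds w)"
  proof (rule connected_induction_simple[where S = U and a = z and b = w and P = "\<lambda>u. eventually (\<lambda>v. g v = 0) (nhds u)"])
    fix p assume p: "p \<in> U"
    obtain c where "has_pseries c g p" using an[OF p] by (auto simp: R_analytic_at_iff)
    then obtain r where r: "r > 0" "(\<lambda>n. r ^ mdeg n * norm (c n)) summable_on UNIV"
      "\<And>w. w - p \<in> cube r \<Longrightarrow> ((\<lambda>n. mon n (w - p) *\<^sub>R c n) has_sum g w) UNIV"
      using has_pseries_radius by blast
    define N where "N = (\<lambda>x. x - p) -` cube r"
    have "N = (\<lambda>x. p + x) ` cube r" unfolding N_def by (auto intro: image_eqI[of _ _ "_ - p"])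
    hence oN: "open N" by (simp add: open_translation open_cube)
    have gen: "L (g v) = 0" if q: "q \<in> N" "eventually (\<lambda>v. g v = 0) (nhds q)" and v: "v \<in> N"
      and L: "bounded_linear L" "\<And>x. norm (L x) \<le> norm x" for q v and L :: "hyp \<Rightarrow> complex"
    proof -
      have ln: "q - p + t *\<^sub>R ((v - p) - (q - p)) = (q + t *\<^sub>R (v - q)) - p" for t by simp
      have "L (g (q + 1 *\<^sub>R (v - q))) = 0"
      proof (rule line_power_series_zero[where r = r and \<gamma> = "\<lambda>n. L (c n)" and q = "q - p" and w = "v - p"
          and G = "\<lambda>t. L (g (q + t *\<^sub>R (v - q)))"])
        show "(\<lambda>n. r ^ mdeg n * norm (L (c n))) summable_on UNIV"
          by (rule summable_on_comparison_test[OF r(2)]) (use L(2) r(1) in \<open>auto intro!: mult_left_mono\<close>)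
        show "q - p \<in> cube r" "v - p \<in> cube r" using q v by (auto simp: N_def)
        show "((\<lambda>n. mon n (q - p + t *\<^sub>R ((v - p) - (q - p))) *\<^sub>R L (c n)) has_sum L (g (q + t *\<^sub>R (v - q)))) UNIV"
          if "q - p + t *\<^sub>R ((v - p) - (q - p)) \<in> cube r" for t
          using has_sum_bounded_linear[OF L(1) r(3)[OF that[unfolded ln]]] unfolding ln
          by (simp add: o_def linear_scale bounded_linear.linear[OF L(1)])
        have "((\<lambda>t. q + t *\<^sub>R (v - q)) \<longlongrightarrow> q) (at_right 0)"
          by (rule tendsto_eq_intros refl | simp)+
        hence "eventually (\<lambda>t. g (q + t *\<^sub>R (v - q)) = 0) (at_right 0)"
          using q(2) unfolding filterlim_def le_filter_def eventually_filtermap by blast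
        thus "eventually (\<lambda>t. L (g (q + t *\<^sub>R (v - q))) = 0) (at_right 0)"
          by eventually_elim (simp add: linear_0 bounded_linear.linear[OF L(1)])
      qed
      thus ?thesis by simp
    qed
    have gN: "g v = 0" if "q \<in> N" "eventually (\<lambda>v. g v = 0) (nhds q)" "v \<in> N" for q v
      using gen[OF that bounded_linear_cpart norm_cpart_le] gen[OF that bounded_linear_npart norm_npart_le]
      by (simp add: hyp_eq_parts) (simp add: cpart_def npart_def complex_eq_iff)
    have "eventually (\<lambda>v. g v = 0) (nhds y)" if "x \<in> N" "eventually (\<lambda>v. g v = 0) (nhds x)" "y \<in> N" for x y
      unfolding eventually_nhds using oN that(3) gN[OF that(1,2)] by blast
    hence "\<forall>x\<in>U \<inter> N. \<forall>y\<in>U \<inter> N. eventually (\<lambda>v. g v = 0) (nhds x) \<longrightarrow> eventually (\<lambda>v. g v = 0) (nhds y)"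
      by blast
    moreover have "p \<in> U \<inter> N" using p r(1) by (simp add: N_def cube_def)
    ultimately show "\<exists>T. openin (top_of_set U) T \<and> p \<in> T \<and>
        (\<forall>x\<in>T. \<forall>y\<in>T. eventually (\<lambda>v. g v = 0) (nhds x) \<longrightarrow> eventually (\<lambda>v. g v = 0) (nhds y))"
      using openin_open_Int[OF oN, of U] by blast
  qed (use U z w in auto)
  thus ?thesis by (rule eventually_nhds_x_imp_x)
qed

subsection \<open>Uniqueness and the expansion theorem\<close>

text \<open>With \<open>x\<^sub>3\<close> and \<open>x\<^sub>4\<close> frozen, \<open>CR\<close> is
  the Cauchy-Riemann equation in \<open>x\<^sub>1 + i x\<^sub>2\<close>, and the prescribed zeros
  fill a segment of the imaginary axis around 0.\<close>

lemma holomorphic_slice_zero: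
  fixes h :: "hyp \<Rightarrow> complex"
  assumes D: "\<And>w. w \<in> cube r \<Longrightarrow> (h has_derivative D w) (at w)"
    and CR: "\<And>w. w \<in> cube r \<Longrightarrow> D w hi = \<i> * D w 1"
    and zero: "\<And>w. w \<in> cube r \<Longrightarrow> hx1 w = 0 \<Longrightarrow> h w = 0"
    and w: "w \<in> cube r"
  shows "h w = 0"
proof -
  define emb where "emb z = Hyp (Re z) (Im z) (hx3 w) (hx4 w)" for z
  define S where "S = {z. \<bar>Re z\<bar> < r \<and> \<bar>Im z\<bar> < r}"
  have S_eq: "S = Re -` ball 0 r \<inter> Im -` ball 0 r" by (auto simp: S_def)
  have "open S" unfolding S_eq
    by (intro open_Int open_vimage open_ball linear_continuous_on bounded_linear_Re bounded_linear_Im)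
  have "convex S" unfolding S_eq
    by (intro convex_Int convex_linear_vimage convex_ball bounded_linear.linear bounded_linear_Re bounded_linear_Im)
  have emb: "emb z \<in> cube r" if "z \<in> S" for z
    using that w by (simp add: emb_def S_def cube_def)
  have hol: "(\<lambda>z. h (emb z)) holomorphic_on S"
    unfolding holomorphic_on_open[OF \<open>open S\<close>]
  proof
    fix z assume z: "z \<in> S"
    have emb_eq: "emb = (\<lambda>z. Re z *\<^sub>R 1 + Im z *\<^sub>R hi + (hx3 w *\<^sub>R hj + hx4 w *\<^sub>R hk))"
      by (simp add: fun_eq_iff emb_def hyp_eq_iff hi_def hj_def hk_def)
    have "(emb has_derivative (\<lambda>k. Re k *\<^sub>R 1 + Im k *\<^sub>R hi)) (at z)"
      unfolding emb_eq by (auto intro!: derivative_eq_intros)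
    from has_derivative_compose[OF this D[OF emb[OF z]]]
    have "((\<lambda>z. h (emb z)) has_derivative (\<lambda>k. D (emb z) (Re k *\<^sub>R 1 + Im k *\<^sub>R hi))) (at z)" .
    moreover have "(\<lambda>k. D (emb z) (Re k *\<^sub>R 1 + Im k *\<^sub>R hi)) = (*) (D (emb z) 1)"
    proof
      fix k
      have "linear (D (emb z))" using D[OF emb[OF z]] by (rule has_derivative_linear)
      hence "D (emb z) (Re k *\<^sub>R 1 + Im k *\<^sub>R hi) = of_real (Re k) * D (emb z) 1 + of_real (Im k) * (\<i> * D (emb z) 1)"
        unfolding linear_add[OF \<open>linear (D (emb z))\<close>] linear_scale[OF \<open>linear (D (emb z))\<close>] CR[OF emb[OF z]]
        by (simp only: scaleR_conv_of_real)
      also have "\<dots> = D (emb z) 1 * (of_real (Re k) + \<i> * of_real (Im k))" by (simp add: algebra_simps)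
      also have "of_real (Re k) + \<i> * of_real (Im k) = k" by (rule complex_eq[symmetric])
      finally show "D (emb z) (Re k *\<^sub>R 1 + Im k *\<^sub>R hi) = D (emb z) 1 * k" .
    qed
    ultimately show "\<exists>f'. ((\<lambda>z. h (emb z)) has_field_derivative f') (at z)"
      unfolding has_field_derivative_def by auto
  qed
  have lim: "(0::complex) islimpt {z \<in> S. Re z = 0}"
    unfolding islimpt_approachable
  proof (intro allI impI)
    fix e :: real assume e: "e > 0"
    have "r > 0" using w by (auto simp: cube_def)
    define t where "t = min e r / 2"
    have "0 < t" "t < e" "t < r" using \<open>r > 0\<close> e by (auto simp: t_def)
    moreover from this have "norm (Complex 0 t) = t" by (simp add: cmod_def)
    ultimately show "\<exists>x'\<in>{z \<in> S. Re z = 0}. x' \<noteq> 0 \<and> dist x' 0 < e"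
      by (intro bexI[of _ "Complex 0 t"]) (auto simp: S_def complex_eq_iff)
  qed
  have h0: "h (emb z) = 0" if "z \<in> {z \<in> S. Re z = 0}" for z
    using that by (intro zero emb) (auto simp: emb_def)
  have "0 \<in> S" "Complex (hx1 w) (hx2 w) \<in> S" using w by (auto simp: S_def cube_def)
  hence "h (emb (Complex (hx1 w) (hx2 w))) = 0"
    by (intro analytic_continuation[OF hol \<open>open S\<close> convex_connected[OF \<open>convex S\<close>] _ _ lim h0]) auto
  thus ?thesis by (simp add: emb_def)
qed

lemma nabla0_eq:
  assumes "(f has_derivative D) (at w)"
  shows "nabla0 f w = D 1 + hi * D hi + hj * D hj + hk * D hk"
  by (simp add: nabla0_def partial_eq[OF assms])

lemma cpart_basis [simp]: "cpart hi = \<i>" "cpart hj = 0" "cpart hk = 0"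
  and npart_basis [simp]: "npart hi = 0" "npart hj = 1" "npart hk = \<i>"
  by (simp_all add: cpart_def npart_def hi_def hj_def hk_def complex_eq_iff)

text \<open>The equation is triangular in \<open>c = cpart h\<close> and \<open>v = npart h\<close>:
  \<open>\<partial>\<^sub>1 c + i \<partial>\<^sub>2 c = 0\<close> and \<open>\<partial>\<^sub>1 v +
  i \<partial>\<^sub>2 v + cnj (\<partial>\<^sub>3 c) + i cnj (\<partial>\<^sub>4 c) = 0\<close>.
  Once \<open>c\<close> vanishes on the open cube, its derivatives do too and \<open>v\<close>
  satisfies the first equation.\<close>

lemma regular_zero_if_zero_on_hyperplane:
  assumes diff: "\<And>w. w \<in> cube r \<Longrightarrow> h differentiable (at w)"
    and reg: "\<And>w. w \<in> cube r \<Longrightarrow> nabla0 h w = 0"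
    and zero: "\<And>w. w \<in> cube r \<Longrightarrow> hx1 w = 0 \<Longrightarrow> h w = 0"
    and w: "w \<in> cube r"
  shows "h w = 0"
proof -
  define D where "D w = frechet_derivative h (at w)" for w
  have D: "(h has_derivative D w) (at w)" if "w \<in> cube r" for w
    unfolding D_def using diff[OF that] by (simp add: frechet_derivative_works)
  have eq: "D w 1 + hi * D w hi + hj * D w hj + hk * D w hk = 0" if "w \<in> cube r" for w
    using nabla0_eq[OF D[OF that]] reg[OF that] by simp
  have z0: "cpart 0 = 0" "npart 0 = 0" by (simp_all add: cpart_def npart_def complex_eq_iff)
  have I: "b = \<i> * a" if "a + \<i> * b = 0" for a b :: complex
  proof -
    have "\<i> * (a + \<i> * b) = 0" using that by simp
    thus ?thesis by (simp add: distrib_left flip: mult.assoc)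
  qed
  have cD: "((\<lambda>w. cpart (h w)) has_derivative (\<lambda>k. cpart (D w k))) (at w)" if "w \<in> cube r" for w
    by (rule bounded_linear.has_derivative[OF bounded_linear_cpart D[OF that]])
  have nD: "((\<lambda>w. npart (h w)) has_derivative (\<lambda>k. npart (D w k))) (at w)" if "w \<in> cube r" for w
    by (rule bounded_linear.has_derivative[OF bounded_linear_npart D[OF that]])
  have c: "cpart (h w) = 0" if "w \<in> cube r" for w
  proof (rule holomorphic_slice_zero[OF cD _ _ that])
    show "cpart (D w hi) = \<i> * cpart (D w 1)" if "w \<in> cube r" for w
      using arg_cong[OF eq[OF that], of cpart] by (intro I) (simp add: z0)
    show "cpart (h w) = 0" if "w \<in> cube r" "hx1 w = 0" for w
      using zero[OF that] by (simp add: z0)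
  qed
  have cD0: "cpart (D w k) = 0" if "w \<in> cube r" for w k
  proof -
    have "((\<lambda>w. cpart (h w)) has_derivative (\<lambda>k. 0)) (at w)"
      by (rule has_derivative_transform_within_open[OF _ open_cube that, of "\<lambda>_. 0"]) (use c in auto)
    from has_derivative_unique[OF cD[OF that] this] show ?thesis by metis
  qed
  have "npart (h w) = 0"
  proof (rule holomorphic_slice_zero[OF nD _ _ w])
    show "npart (D w hi) = \<i> * npart (D w 1)" if "w \<in> cube r" for w
      using arg_cong[OF eq[OF that], of npart] by (intro I) (simp add: z0 cD0[OF that])
    show "npart (h w) = 0" if "w \<in> cube r" "hx1 w = 0" for w
      using zero[OF that] by (simp add: z0)
  qed
  thus ?thesis using c[OF w] by (simp add: hyp_eq_parts z0)
qed

section \<open>Comparison of a function with its expansion\<close>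

lemma dpow_of_real: "dpow j k (of_real x) = of_real (dpow j k x)"
  by (simp add: dpow_def)

lemma eta_pow_on_hyperplane:
  assumes "hx1 w = 0"
  shows "eta_pow (a, b, c) w = (hx2 w ^ a * hx3 w ^ b * hx4 w ^ c / (fact a * fact b * fact c)) *\<^sub>R 1"
proof -
  have z: "zeta w = of_real (hx2 w)" using assms by (simp add: zeta_def complex_eq_iff)
  have "etaD 0 0 0 (a, b, c) w = (dpow 0 a (hx2 w) * (dpow 0 b (hx3 w) * dpow 0 c (hx4 w))) *\<^sub>R 1"
    unfolding hyp_eq_parts cpart_etaD npart_etaD z dpow_of_real
    by (simp add: cpart_def npart_def complex_eq_iff)
  thus ?thesis unfolding eta_pow_eq_etaD by (simp add: dpow_def)
qed

lemma eta_expansion_at_iff: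
  "eta_expansion_at f w \<longleftrightarrow> ((\<lambda>n. eta_pow n w * eta_coeff f n) has_sum f w) UNIV"
proof -
  define E where "E = (\<lambda>n. eta_pow n w * eta_coeff f n)"
  have "etaD 0 0 0 (0, 0, 0) w = 1"
    by (simp add: hyp_eq_parts cpart_etaD npart_etaD)
      (simp add: cpart_def npart_def dpow_def complex_eq_iff zeta_def)
  hence E0: "E (0, 0, 0) = f 0" by (simp add: E_def eta_pow_eq_etaD del: eta_pow.simps)
  have U: "insert (0, 0, 0) (- {(0, 0, 0)}) = (UNIV :: (nat \<times> nat \<times> nat) set)" by auto
  show ?thesis
    unfolding eta_expansion_at_def E_def[symmetric]
  proof
    assume *: "E summable_on - {(0, 0, 0)} \<and> f w = f 0 + infsum E (- {(0, 0, 0)})"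
    hence "(E has_sum (E (0, 0, 0) + infsum E (- {(0, 0, 0)}))) (insert (0, 0, 0) (- {(0, 0, 0)}))"
      by (intro has_sum_insert has_sum_infsum) auto
    thus "(E has_sum f w) UNIV" using * by (simp add: U E0)
  next
    assume *: "(E has_sum f w) UNIV"
    have "(E has_sum f 0) {(0, 0, 0)}" using has_sum_finite[of "{(0, 0, 0)}" E] by (simp add: E0)
    from has_sum_Diff[OF * this] have "(E has_sum (f w - f 0)) (- {(0, 0, 0)})"
      by (simp add: Compl_eq_Diff_UNIV)
    thus "E summable_on - {(0, 0, 0)} \<and> f w = f 0 + infsum E (- {(0, 0, 0)})"
      by (auto simp: summable_on_def infsumI)
  qed
qed

lemma left_regular_if_eta_expansion:
  assumes V: "open V" and ex: "\<And>w. w \<in> V \<Longrightarrow> eta_expansion_at f w"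
  shows "left_regular V f"
proof -
  define \<phi> where "\<phi> = eta_coeff f"
  have hs: "((\<lambda>n. etaD 0 0 0 n w * \<phi> n) has_sum f w) UNIV" if "w \<in> V" for w
    using ex[OF that] by (simp add: eta_expansion_at_iff eta_pow_eq_etaD \<phi>_def)
  define g where "g w = (\<Sum>\<^sub>\<infinity>n. etaD 0 0 0 n w * \<phi> n)" for w
  have fg: "f w = g w" if "w \<in> V" for w using hs[OF that] by (simp add: g_def infsumI)
  have "f differentiable (at w) \<and> nabla0 f w = 0" if w: "w \<in> V" for w
  proof -
    obtain R2 R3 R4 where R: "norm (zeta w) < R2" "\<bar>hx3 w\<bar> < R3" "\<bar>hx4 w\<bar> < R4"
      "(\<lambda>n. box_weight R2 R3 R4 n * norm (\<phi> n)) summable_on UNIV"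
      using eta_series_majorant[OF V w has_sum_imp_summable[OF hs]] by blast
    note reg = eta_series_regular[OF R(4,1,2,3), folded g_def]
    obtain D where D: "(g has_derivative D) (at w)" using reg(2) by (auto simp: differentiable_def)
    have Df: "(f has_derivative D) (at w)"
      by (rule has_derivative_transform_within_open[OF D V w]) (simp add: fg)
    have "nabla0 f w = nabla0 g w" using nabla0_eq[OF D] nabla0_eq[OF Df] by simp
    thus ?thesis using reg(3) Df by (auto simp: differentiable_def)
  qed
  thus ?thesis by (auto simp: left_regular_def R_differentiable_def)
qed

lemma eta_expansion_if_left_regular:
  assumes "open U" "0 \<in> U" "R_analytic_at f 0" "left_regular U f"
  shows "eventually (eta_expansion_at f) (nhds 0)"
proof -
  obtain c where c: "has_pseries c f 0" using assms(3) by (auto simp: R_analytic_at_iff)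
  obtain r where r: "r > 0" "(\<lambda>n. r ^ mdeg n * norm (c n)) summable_on UNIV"
    "\<And>w. w - 0 \<in> cube r \<Longrightarrow> ((\<lambda>n. mon n (w - 0) *\<^sub>R c n) has_sum f w) UNIV"
    using has_pseries_radius[OF c] by blast
  obtain e where e: "e > 0" "ball 0 e \<subseteq> U" using assms(1,2) open_contains_ball by blast
  \<comment> \<open>The bound \<open>r / 2\<close> keeps \<bar>zeta\<bar>, at most the sum of two
    coordinates, below \<open>r\<close>; \<open>e / 5\<close> keeps the norm, at most the sum of
    four, below \<open>e\<close>.\<close>
  define \<rho> where "\<rho> = min (r / 2) (e / 5)"
  have \<rho>: "\<rho> > 0" using r(1) e(1) by (simp add: \<rho>_def)
  have cU: "w \<in> U" if "w \<in> cube \<rho>" for w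
  proof -
    have "norm w < e" using that norm_hyp_le_sum[of w] e(1) by (simp add: cube_def \<rho>_def)
    thus ?thesis using e by auto
  qed
  define \<phi> where "\<phi> = eta_coeff f"
  have \<phi>: "\<phi> (a, b, d) = (fact a * fact b * fact d) *\<^sub>R c (0, a, b, d)" for a b d
    unfolding \<phi>_def by (rule eta_coeff_eq[OF c])
  have inj: "inj (Pair (0::nat) :: nat \<times> nat \<times> nat \<Rightarrow> midx)" by (auto simp: inj_def)
  have "(\<lambda>n. r ^ mdeg n * norm (c n)) summable_on range (Pair 0)"
    by (rule summable_on_subset_banach[OF r(2)]) simp
  hence "(\<lambda>n. r ^ mdeg (0, n) * norm (c (0, n))) summable_on UNIV"
    using summable_on_reindex[OF inj, of "\<lambda>n. r ^ mdeg n * norm (c n)"] by (simp add: o_def)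
  \<comment> \<open>The factorials in \<open>\<phi>\<close> cancel those of the divided powers in
    the weight.\<close>
  moreover have "r ^ mdeg (0, n) * norm (c (0, n)) = box_weight r r r n * norm (\<phi> n)" for n
    by (cases n) (simp add: mdeg_def box_weight_def dpow_def \<phi> power_add)
  ultimately have sm: "(\<lambda>n. box_weight r r r n * norm (\<phi> n)) summable_on UNIV" by simp
  define g where "g w = (\<Sum>\<^sub>\<infinity>n. etaD 0 0 0 n w * \<phi> n)" for w
  have b: "norm (zeta w) < r" "\<bar>hx3 w\<bar> < r" "\<bar>hx4 w\<bar> < r" if "w \<in> cube \<rho>" for w
    using that cmod_le[of "zeta w"] r(1) by (auto simp: cube_def \<rho>_def zeta_def)
  note reg = eta_series_regular[OF sm b, folded g_def]
  have f: "f differentiable (at w)" "nabla0 f w = 0" if "w \<in> cube \<rho>" for w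
    using assms(4) cU[OF that] by (auto simp: left_regular_def R_differentiable_def)
  have fg: "f w = g w" if w: "w \<in> cube \<rho>" for w
  proof -
    have "f w - g w = 0"
    proof (rule regular_zero_if_zero_on_hyperplane[of \<rho> "\<lambda>w. f w - g w"])
      fix v assume v: "v \<in> cube \<rho>"
      show "(\<lambda>w. f w - g w) differentiable (at v)"
        using f(1)[OF v] reg(2)[OF v v v] by (rule differentiable_diff)
      obtain D1 D2 where D: "(f has_derivative D1) (at v)" "(g has_derivative D2) (at v)"
        using f(1)[OF v] reg(2)[OF v v v] by (auto simp: differentiable_def)
      have "nabla0 (\<lambda>w. f w - g w) v = nabla0 f v - nabla0 g v"
        unfolding nabla0_eq[OF D(1)] nabla0_eq[OF D(2)] nabla0_eq[OF has_derivative_diff[OF D]]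
        by (simp add: algebra_simps)
      thus "nabla0 (\<lambda>w. f w - g w) v = 0" using f(2)[OF v] reg(3)[OF v v v] by simp
    next
      fix v assume v: "v \<in> cube \<rho>" and v1: "hx1 v = 0"
      have "((\<lambda>n. mon n v *\<^sub>R c n) has_sum f v) UNIV"
        using r(3)[of v] v r(1) by (auto simp: cube_def \<rho>_def)
      \<comment> \<open>On the hyperplane only monomials with exponent 0 in \<open>x\<^sub>1\<close>
        survive, and \<open>0 ^ 0 = 1\<close> there; \<open>Pair 0\<close> indexes them.\<close>
      also have "?this \<longleftrightarrow> ((\<lambda>n. mon n v *\<^sub>R c n) has_sum f v) (range (Pair 0))"
        by (rule has_sum_cong_neutral) (auto simp: mon_def v1 power_0_left image_iff)
      also have "\<dots> \<longleftrightarrow> ((\<lambda>n. mon (0, n) v *\<^sub>R c (0, n)) has_sum f v) UNIV"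
        using has_sum_reindex[OF inj, of "\<lambda>n. mon n v *\<^sub>R c n"] by (simp add: o_def)
      also have "(\<lambda>n. mon (0, n) v *\<^sub>R c (0, n)) = (\<lambda>n. etaD 0 0 0 n v * \<phi> n)"
      proof
        fix n :: "nat \<times> nat \<times> nat"
        obtain x y z where n: "n = (x, y, z)" by (cases n)
        show "mon (0, n) v *\<^sub>R c (0, n) = etaD 0 0 0 n v * \<phi> n"
          using eta_pow_on_hyperplane[OF v1, of x y z]
          by (simp add: n mon_def \<phi> eta_pow_eq_etaD del: eta_pow.simps)
      qed
      finally show "f v - g v = 0" by (simp add: g_def infsumI)
    qed (rule w)
    thus ?thesis by simp
  qed
  have "eta_expansion_at f w" if w: "w \<in> cube \<rho>" for w
    using has_sum_infsum[OF reg(1)[OF w w w]]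
    by (simp add: eta_expansion_at_iff eta_pow_eq_etaD fg[OF w] g_def \<phi>_def del: eta_pow.simps)
  thus ?thesis using eventually_cube[OF \<rho>, of 0] by (auto elim: eventually_mono)
qed

text \<open>The series depends only on the germ of \<open>f\<close> at 0, so the equality is local:
  a holomorphic function of \<open>x\<^sub>1 + i x\<^sub>2\<close> with a pole outside
  \<open>U\<close> is regular on \<open>U\<close> although its series may diverge in parts of
  \<open>U\<close>. Conversely, an expansion yields regularity on the open set where it holds; a
  function that is zero near 0 and not regular elsewhere shows that this cannot reach all of
  \<open>U\<close> from the germ alone. Analyticity on \<open>U\<close> closes that gap in the third
  conjunct.\<close>

theorem theorem54:
  fixes f :: "hyp \<Rightarrow> hyp" and U :: "hyp set"
  assumes "openin hyp_topology U" and "connectedin hyp_topology U" and "0 \<in> U"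
    and "f \<in> R_differentiable U"
    and "R_analytic_at f 0"
  shows "(left_regular U f \<longrightarrow> (\<forall>\<^sub>F w in nhds 0. eta_expansion_at f w)) \<and>
    (\<forall>V. open V \<and> 0 \<in> V \<and> V \<subseteq> U \<and> (\<forall>w\<in>V. eta_expansion_at f w) \<longrightarrow> left_regular V f) \<and>
    ((\<forall>p\<in>U. R_analytic_at f p) \<longrightarrow>
       (left_regular U f \<longleftrightarrow> (\<forall>\<^sub>F w in nhds 0. eta_expansion_at f w)))"
proof -
  have "open U" using assms(1) by (simp add: openin_hyp_topology_iff)
  have A: "eventually (eta_expansion_at f) (nhds 0)" if "left_regular U f"
    using eta_expansion_if_left_regular[OF \<open>open U\<close> assms(3,5) that] .
  have C: "left_regular U f"
    if an: "\<forall>p\<in>U. R_analytic_at f p" and ex: "eventually (eta_expansion_at f) (nhds 0)"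
  proof -
    obtain W where W: "open W" "0 \<in> W" "\<And>w. w \<in> W \<Longrightarrow> eta_expansion_at f w"
      using ex by (auto simp: eventually_nhds)
    have "left_regular W f" by (rule left_regular_if_eta_expansion[OF W(1,3)])
    hence "eventually (\<lambda>w. nabla0 f w = 0) (nhds 0)"
      using W(1,2) by (auto simp: left_regular_def eventually_nhds)
    hence "nabla0 f w = 0" if "w \<in> U" for w
      using connected_if_connectedin_hyp_topology[OF assms(1,2)] \<open>open U\<close> assms(3) that an
      by (intro R_analytic_identity[of U "nabla0 f" 0 w]) (auto intro: R_analytic_at_nabla0)
    thus ?thesis using assms(4) by (simp add: left_regular_def)
  qed
  show ?thesis
    using A C by (intro conjI allI impI iffI) (auto intro: left_regular_if_eta_expansion)
qed

end
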